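(* Let $T=R_\lambda\phi(B)$, with $\phi\in H^\infty(\mathbb{D})$, be an extended $\lambda$-eigenoperator of $B$ on $H^2(\mathbb{D})$, and assume that $\lambda^n=1$ for some positive integer $n$. Put $\Phi(z)=\phi(z)\phi(\lambda z)\cdots\phi(\lambda^{n-1}z)$. Then $T$ is hypercyclic if and only if $\Phi(\mathbb{D})\cap\partial\mathbb{D}\neq\emptyset$.
   Context: $\mathbb{D}$ is the open unit disk, $H^2(\mathbb{D})$ the Hardy space. $B$ is the backward shift: $B1=0$, $Bz^n=z^{n-1}$ for $n\ge1$. An extended $\lambda$-eigenoperator of $B$ is a bounded operator $X\neq0$ with $BX=\lambda XB$. $R_\lambda f(z)=f(\lambda z)$. For $\phi\in H^\infty(\mathbb{D})$, $\phi(B)$ denotes $M_{\overline{\phi}}^\star$, the adjoint of multiplication by $\overline{\phi}(z):=\overline{\phi(\overline{z})}$ on $H^2(\mathbb{D})$ (i.e. $\sum_k c_kB^k$ if $\phi=\sum_k c_kz^k$). For $|\lambda|=1$, the extended $\lambda$-eigenoperators of $B$ are exactly the operators $R_\lambda\phi(B)$ with $0\ne\phi\in H^\infty(\mathbb{D})$. A bounded operator $T$ is hypercyclic if there is a vector $f$ whose orbit $\{T^nf: n\in\mathbb{N}\}$ is dense.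
   Formalization: The formal statement additionally assumes that Φ is not a constant of modulus 1 on the disk; in that case Φ(D) meets the unit circle but T^n = cI with |c| = 1, so T is not hypercyclic and the printed equivalence fails (e.g. λ = 1, n = 1, φ = 1, T = I). *)

theory Defs
  imports "HOL-Complex_Analysis.Complex_Analysis"
begin

abbreviation unit_disc :: "complex set" where
  "unit_disc \<equiv> ball 0 1"

definition taylor_coeff :: "(complex \<Rightarrow> complex) \<Rightarrow> nat \<Rightarrow> complex" where
  "taylor_coeff f n = (deriv ^^ n) f 0 / fact n"

(* The Hardy space of holomorphic functions on the disc with square-summable Taylor coefficients.
   Functions are normalised to vanish outside the disc, so that equality of representatives is
   equality on the disc. *)
definition hardy2_set :: "(complex \<Rightarrow> complex) set" where
  "hardy2_set = {f. f holomorphic_on unit_disc \<and> (\<forall>z. z \<notin> unit_disc \<longrightarrow> f z = 0) \<and>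
                    summable (\<lambda>n. (cmod (taylor_coeff f n))\<^sup>2)}"

lemma taylor_coeff_const_zero [simp]: "taylor_coeff (\<lambda>_. 0) n = 0"
  by (simp add: taylor_coeff_def)

lemma taylor_coeff_add:
  assumes "f holomorphic_on unit_disc" "g holomorphic_on unit_disc"
  shows "taylor_coeff (\<lambda>z. f z + g z) n = taylor_coeff f n + taylor_coeff g n"
  unfolding taylor_coeff_def
  by (subst higher_deriv_add[OF assms]) (auto simp: add_divide_distrib)

lemma taylor_coeff_cmult:
  assumes "f holomorphic_on unit_disc"
  shows "taylor_coeff (\<lambda>z. c * f z) n = c * taylor_coeff f n"
  unfolding taylor_coeff_def
  by (subst higher_deriv_cmult[OF assms]) auto

lemma summable_square_add:
  fixes a b :: "nat \<Rightarrow> complex"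
  assumes "summable (\<lambda>n. (cmod (a n))\<^sup>2)" "summable (\<lambda>n. (cmod (b n))\<^sup>2)"
  shows "summable (\<lambda>n. (cmod (a n + b n))\<^sup>2)"
proof (rule summable_comparison_test')
  show "summable (\<lambda>n. 2 * (cmod (a n))\<^sup>2 + 2 * (cmod (b n))\<^sup>2)"
    using assms by (intro summable_add summable_mult)
  fix n
  have "(cmod (a n + b n))\<^sup>2 \<le> (cmod (a n) + cmod (b n))\<^sup>2"
    by (intro power_mono norm_triangle_ineq) auto
  also have "\<dots> \<le> 2 * (cmod (a n))\<^sup>2 + 2 * (cmod (b n))\<^sup>2"
    using sum_squares_bound[of "cmod (a n)" "cmod (b n)"] by (simp add: power2_sum)
  finally show "norm ((cmod (a n + b n))\<^sup>2) \<le> 2 * (cmod (a n))\<^sup>2 + 2 * (cmod (b n))\<^sup>2"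
    by simp
qed

lemma summable_square_mult:
  fixes a b :: "nat \<Rightarrow> complex"
  assumes "summable (\<lambda>n. (cmod (a n))\<^sup>2)" "summable (\<lambda>n. (cmod (b n))\<^sup>2)"
  shows "summable (\<lambda>n. a n * cnj (b n))"
proof (rule summable_comparison_test')
  show "summable (\<lambda>n. (cmod (a n))\<^sup>2 + (cmod (b n))\<^sup>2)"
    using assms by (rule summable_add)
  fix n
  have "cmod (a n) * cmod (b n) \<ge> 0"
    by simp
  then show "norm (a n * cnj (b n)) \<le> (cmod (a n))\<^sup>2 + (cmod (b n))\<^sup>2"
    using sum_squares_bound[of "cmod (a n)" "cmod (b n)"] unfolding norm_mult complex_mod_cnj
    by linarith
qed

lemma hardy2_set_zero: "(\<lambda>_. 0) \<in> hardy2_set"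
  by (simp add: hardy2_set_def)

lemma hardy2_set_add: "f \<in> hardy2_set \<Longrightarrow> g \<in> hardy2_set \<Longrightarrow> (\<lambda>z. f z + g z) \<in> hardy2_set"
  by (auto simp: hardy2_set_def taylor_coeff_add intro!: holomorphic_intros summable_square_add)

lemma hardy2_set_cmult: "f \<in> hardy2_set \<Longrightarrow> (\<lambda>z. c * f z) \<in> hardy2_set"
  by (auto simp: hardy2_set_def taylor_coeff_cmult norm_mult power_mult_distrib
           intro!: holomorphic_intros summable_mult)

lemma hardy2_set_eq_zero:
  assumes "f \<in> hardy2_set" "\<And>n. taylor_coeff f n = 0"
  shows "f = (\<lambda>_. 0)"
proof
  fix z
  show "f z = 0"
  proof (cases "z \<in> unit_disc")
    case True
    show ?thesis
    proof (rule holomorphic_fun_eq_0_on_ball[where f = f and z = 0 and r = 1])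
      show "f holomorphic_on unit_disc"
        using assms by (simp add: hardy2_set_def)
      show "z \<in> unit_disc"
        by (fact True)
      show "(deriv ^^ n) f 0 = 0" for n
        using assms(2)[of n] by (auto simp: taylor_coeff_def)
    qed
  qed (use assms in \<open>auto simp: hardy2_set_def\<close>)
qed

typedef hardy2 = hardy2_set
  morphisms hfun Abs_hardy2
  using hardy2_set_zero by blast

definition hscale :: "complex \<Rightarrow> hardy2 \<Rightarrow> hardy2" where
  "hscale c f = Abs_hardy2 (\<lambda>z. c * hfun f z)"

definition hcoeff :: "hardy2 \<Rightarrow> nat \<Rightarrow> complex" where
  "hcoeff f n = taylor_coeff (hfun f) n"

definition hinner :: "hardy2 \<Rightarrow> hardy2 \<Rightarrow> complex" where
  "hinner f g = (\<Sum>n. hcoeff f n * cnj (hcoeff g n))"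

lemma hfun_hscale: "hfun (hscale c f) z = c * hfun f z"
  unfolding hscale_def by (subst Abs_hardy2_inverse) (auto intro: hardy2_set_cmult hfun)

lemma hfun_holomorphic: "hfun f holomorphic_on unit_disc"
  using hfun[of f] by (simp add: hardy2_set_def)

lemma hcoeff_hscale: "hcoeff (hscale c f) n = c * hcoeff f n"
  unfolding hcoeff_def hfun_hscale[abs_def] by (intro taylor_coeff_cmult hfun_holomorphic)

lemma summable_hcoeff: "summable (\<lambda>n. (cmod (hcoeff f n))\<^sup>2)"
  using hfun[of f] by (simp add: hardy2_set_def hcoeff_def)

lemma summable_hinner: "summable (\<lambda>n. hcoeff f n * cnj (hcoeff g n))"
  by (intro summable_square_mult summable_hcoeff)

(* The real inner product is the real part of the complex one, so the norm is the Hardy space norm. *)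
instantiation hardy2 :: real_inner
begin

definition zero_hardy2 :: hardy2 where
  "0 = Abs_hardy2 (\<lambda>_. 0)"
definition plus_hardy2 :: "hardy2 \<Rightarrow> hardy2 \<Rightarrow> hardy2" where
  "f + g = Abs_hardy2 (\<lambda>z. hfun f z + hfun g z)"
definition uminus_hardy2 :: "hardy2 \<Rightarrow> hardy2" where
  "- f = hscale (-1) f"
definition minus_hardy2 :: "hardy2 \<Rightarrow> hardy2 \<Rightarrow> hardy2" where
  "f - g = f + - (g :: hardy2)"
definition scaleR_hardy2 :: "real \<Rightarrow> hardy2 \<Rightarrow> hardy2" where
  "scaleR r f = hscale (of_real r) f"
definition inner_hardy2 :: "hardy2 \<Rightarrow> hardy2 \<Rightarrow> real" where
  "inner f g = Re (hinner f g)"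
definition norm_hardy2 :: "hardy2 \<Rightarrow> real" where
  "norm f = sqrt (inner f (f :: hardy2))"
definition dist_hardy2 :: "hardy2 \<Rightarrow> hardy2 \<Rightarrow> real" where
  "dist f g = norm (f - g :: hardy2)"
definition sgn_hardy2 :: "hardy2 \<Rightarrow> hardy2" where
  "sgn f = scaleR (inverse (norm f)) (f :: hardy2)"
definition uniformity_hardy2 :: "(hardy2 \<times> hardy2) filter" where
  "uniformity = (INF e\<in>{0 <..}. principal {(f, g :: hardy2). dist f g < e})"
definition open_hardy2 :: "hardy2 set \<Rightarrow> bool" where
  "open U = (\<forall>f\<in>U. eventually (\<lambda>(f', g). f' = f \<longrightarrow> g \<in> U) (uniformity :: (hardy2 \<times> hardy2) filter))"

instance
proof
  have [simp]: "hfun (0 :: hardy2) z = 0" for z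
    unfolding zero_hardy2_def by (subst Abs_hardy2_inverse) (auto intro: hardy2_set_zero)
  have [simp]: "hfun (f + g) z = hfun f z + hfun g z" for f g :: hardy2 and z
    unfolding plus_hardy2_def by (subst Abs_hardy2_inverse) (auto intro: hardy2_set_add hfun)
  have [simp]: "hfun (- f) z = - hfun f z" for f :: hardy2 and z
    by (simp add: uminus_hardy2_def hfun_hscale)
  have [simp]: "hfun (scaleR r f) z = of_real r * hfun f z" for f :: hardy2 and r z
    by (simp add: scaleR_hardy2_def hfun_hscale)
  have ext: "f = g" if "\<And>z. hfun f z = hfun g z" for f g
    using that by (auto simp: fun_eq_iff simp flip: hfun_inject)
  have coeff_add: "hcoeff (f + g) n = hcoeff f n + hcoeff g n" for f g :: hardy2 and n
  proof -
    have "hfun (f + g) = (\<lambda>z. hfun f z + hfun g z)"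
      by auto
    then show ?thesis
      by (simp add: hcoeff_def taylor_coeff_add hfun_holomorphic)
  qed
  fix f g h :: hardy2 and r s :: real and U :: "hardy2 set"
  show "f + g + h = f + (g + h)" "f + g = g + f" "0 + f = f" "- f + f = 0" "f - g = f + - g"
    "scaleR r (f + g) = scaleR r f + scaleR r g" "scaleR (r + s) f = scaleR r f + scaleR s f"
    "scaleR r (scaleR s f) = scaleR (r * s) f" "scaleR 1 f = f"
    by (auto intro!: ext simp: minus_hardy2_def algebra_simps)
  show "sgn f = scaleR (inverse (norm f)) (f :: hardy2)" "dist f g = norm (f - g)"
    "(uniformity :: (hardy2 \<times> hardy2) filter) = (INF e\<in>{0 <..}. principal {(x, y). dist x y < e})"
    "open U = (\<forall>x\<in>U. eventually (\<lambda>(x', y). x' = x \<longrightarrow> y \<in> U) uniformity)"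
    "norm f = sqrt (inner f f)"
    by (simp_all add: sgn_hardy2_def dist_hardy2_def uniformity_hardy2_def open_hardy2_def
                      norm_hardy2_def)
  have inner_eq: "inner f g = (\<Sum>n. Re (hcoeff f n * cnj (hcoeff g n)))" for f g :: hardy2
    by (simp only: inner_hardy2_def hinner_def Re_suminf[OF summable_hinner])
  have sm: "summable (\<lambda>n. Re (hcoeff f n * cnj (hcoeff g n)))" for f g
    by (intro summable_Re summable_hinner)
  show "inner f g = inner g f"
    by (simp add: inner_eq mult_ac)
  show "inner (f + g) h = inner f h + inner g h"
    unfolding inner_eq by (subst suminf_add[OF sm sm]) (simp add: coeff_add algebra_simps)
  show "inner (scaleR r f) g = r * inner f g"
    unfolding inner_eq by (subst suminf_mult[OF sm, symmetric])
                          (simp add: scaleR_hardy2_def hcoeff_hscale algebra_simps)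
  have self: "inner f f = (\<Sum>n. (cmod (hcoeff f n))\<^sup>2)"
    unfolding inner_eq by (simp add: complex_mult_cnj cmod_power2)
  show "0 \<le> inner f f"
    unfolding self by (intro suminf_nonneg summable_hcoeff) auto
  show "inner f f = 0 \<longleftrightarrow> f = 0"
  proof
    assume "inner f f = 0"
    then have "hcoeff f n = 0" for n
      unfolding self using suminf_eq_zero_iff[OF summable_hcoeff, of f] by auto
    then have "hfun f = (\<lambda>_. 0)"
      by (intro hardy2_set_eq_zero hfun) (simp add: hcoeff_def)
    then show "f = 0"
      by (intro ext) simp
  next
    assume "f = 0"
    then have "hfun f = (\<lambda>_. 0)"
      by auto
    then show "inner f f = 0"
      by (simp add: self hcoeff_def)
  qed
qed

end

(* Sends a function on the disc to the corresponding element of the Hardy space; meaningful only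
   when the function does lie in the Hardy space. *)
definition h2_of :: "(complex \<Rightarrow> complex) \<Rightarrow> hardy2" where
  "h2_of f = Abs_hardy2 (\<lambda>z. if z \<in> unit_disc then f z else 0)"

definition backward_shift :: "hardy2 \<Rightarrow> hardy2" where
  "backward_shift f =
     h2_of (\<lambda>z. if z = 0 then deriv (hfun f) 0 else (hfun f z - hfun f 0) / z)"

lemma taylor_coeff_monom:
  "taylor_coeff (\<lambda>z. if z \<in> unit_disc then z ^ n else 0) k = (if k = n then 1 else 0)"
proof -
  have "(deriv ^^ k) (\<lambda>z. if z \<in> unit_disc then z ^ n else 0) 0 = (deriv ^^ k) (\<lambda>z. (z - 0) ^ n) 0"
    by (rule higher_deriv_transform_within_open[where S = unit_disc])
       (auto intro!: holomorphic_intros intro: holomorphic_transform[of "\<lambda>z. z ^ n"])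
  also have "\<dots> = pochhammer (of_nat (Suc n - k)) k * (0 - 0) ^ (n - k)"
    by (rule higher_deriv_power)
  also have "\<dots> = (if k = n then fact n else 0)"
    by (cases k n rule: linorder_cases) (auto simp: pochhammer_fact pochhammer_0_left)
  finally show ?thesis
    by (simp add: taylor_coeff_def)
qed

lemma hfun_h2_of_monom: "hfun (h2_of (\<lambda>z. z ^ n)) = (\<lambda>z. if z \<in> unit_disc then z ^ n else 0)"
proof -
  have "(\<lambda>z. if z \<in> unit_disc then z ^ n else 0 :: complex) \<in> hardy2_set"
    unfolding hardy2_set_def
  proof (intro CollectI conjI allI impI)
    show "(\<lambda>z. if z \<in> unit_disc then z ^ n else 0 :: complex) holomorphic_on unit_disc"
      by (rule holomorphic_transform[of "\<lambda>z. z ^ n"]) (auto intro!: holomorphic_intros)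
    show "summable (\<lambda>k. (cmod (taylor_coeff (\<lambda>z. if z \<in> unit_disc then z ^ n else 0) k))\<^sup>2)"
      unfolding taylor_coeff_monom by (rule summable_finite[of "{n}"]) auto
  qed auto
  then show ?thesis
    unfolding h2_of_def by (rule Abs_hardy2_inverse)
qed

lemma deriv_monom_at_0: "deriv (\<lambda>z. if z \<in> unit_disc then z ^ n else 0) 0 = (if n = 1 then 1 else 0)"
  using taylor_coeff_monom[of n 1] by (simp add: taylor_coeff_def)

lemma h2_of_cong: "(\<And>z. z \<in> unit_disc \<Longrightarrow> f z = g z) \<Longrightarrow> h2_of f = h2_of g"
  unfolding h2_of_def by (intro arg_cong[of _ _ Abs_hardy2]) auto

(* The defining action on monomials. *)
lemma backward_shift_one: "backward_shift (h2_of (\<lambda>z. z ^ 0)) = 0"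
proof -
  have "backward_shift (h2_of (\<lambda>z. z ^ 0)) = h2_of (\<lambda>_. 0)"
    unfolding backward_shift_def hfun_h2_of_monom deriv_monom_at_0 by (rule h2_of_cong) auto
  then show ?thesis
    by (simp add: h2_of_def zero_hardy2_def)
qed

lemma backward_shift_monom: "backward_shift (h2_of (\<lambda>z. z ^ Suc n)) = h2_of (\<lambda>z. z ^ n)"
  unfolding backward_shift_def hfun_h2_of_monom deriv_monom_at_0 by (rule h2_of_cong) auto

definition dilation :: "complex \<Rightarrow> hardy2 \<Rightarrow> hardy2" where
  "dilation lam f = h2_of (\<lambda>z. hfun f (lam * z))"

definition h_infinity :: "(complex \<Rightarrow> complex) set" where
  "h_infinity = {\<phi>. \<phi> holomorphic_on unit_disc \<and> bounded (\<phi> ` unit_disc)}"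

definition mult_operator :: "(complex \<Rightarrow> complex) \<Rightarrow> hardy2 \<Rightarrow> hardy2" where
  "mult_operator \<phi> f = h2_of (\<lambda>z. \<phi> z * hfun f z)"

definition hadjoint :: "(hardy2 \<Rightarrow> hardy2) \<Rightarrow> hardy2 \<Rightarrow> hardy2" where
  "hadjoint M = (SOME A. \<forall>f g. hinner (M f) g = hinner f (A g))"

definition shift_calculus :: "(complex \<Rightarrow> complex) \<Rightarrow> hardy2 \<Rightarrow> hardy2" where
  "shift_calculus \<phi> = hadjoint (mult_operator (\<lambda>z. cnj (\<phi> (cnj z))))"

definition bounded_operator :: "(hardy2 \<Rightarrow> hardy2) \<Rightarrow> bool" where
  "bounded_operator T \<longleftrightarrow> bounded_linear T \<and> (\<forall>c f. T (hscale c f) = hscale c (T f))"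

definition extended_eigenoperator :: "complex \<Rightarrow> (hardy2 \<Rightarrow> hardy2) \<Rightarrow> bool" where
  "extended_eigenoperator lam X \<longleftrightarrow>
     bounded_operator X \<and> X \<noteq> (\<lambda>_. 0) \<and>
     (\<forall>f. backward_shift (X f) = hscale lam (X (backward_shift f)))"

definition hypercyclic :: "(hardy2 \<Rightarrow> hardy2) \<Rightarrow> bool" where
  "hypercyclic T \<longleftrightarrow> (\<exists>f. closure (range (\<lambda>m. (T ^^ m) f)) = UNIV)"

(* Pitfall: for T = dilation lam o shift_calculus phi with lam ^ n = 1, T ^^ n is the shift calculus
   of this product. If the product is a constant c with |c| = 1 then T ^^ n = c I, so T is not
   hypercyclic although the image of the disc meets the circle; e.g. phi = exp, lam = -1, n = 2. *)
definition orbit_product :: "complex \<Rightarrow> nat \<Rightarrow> (complex \<Rightarrow> complex) \<Rightarrow> complex \<Rightarrow> complex" where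
  "orbit_product lam n \<phi> z = (\<Prod>k<n. \<phi> (lam ^ k * z))"

end

(* As lam^n = 1, the intertwining of dilations with the functional calculus of the backward shift B
   gives T^n = Phi(B) with Phi the orbit product; this is checked on adjoints, where it is an identity
   between multiplication operators. If Phi(D) misses the circle, then by connectedness |Phi| < 1 or
   |Phi| > 1 throughout D. In the first case T^n is a contraction and all orbits of T are bounded; in the
   second (1/Phi)(B) is a contraction inverting T^n and the orbits of T stay away from 0. If Phi(D) meets
   the circle, then, Phi being nonconstant, it is open and meets both the inside and the outside of the
   circle. The functions 1/(1 - a z) are eigenvectors of Phi(B) with eigenvalue Phi(a), and those with a
   in any nonempty open set span a dense subspace, so Phi(B) is hypercyclic (Godefroy-Shapiro), hence so
   is T. *)
theory Submission
  imports Defs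
begin

subsection \<open>Hilbert and Banach spaces\<close>

text \<open>The norm is defined through Taylor coefficients, while \<open>\<phi>\<close> acts on
  values. Parseval on circles of radius r < 1, with bounds uniform in r, connects the two and gives
  the contraction estimates without boundary values. A second obstacle is that
  \<open>hadjoint\<close> is a mere choice: nothing is known about \<open>shift_calculus\<close>
  until an adjoint is shown to exist, and from then on every identity is tested against
  \<open>hinner\<close>. The Baire argument needs completeness and a countable dense set, hence the
  description of the space by square-summable sequences. Passing between T and its n-th power is
  cheap: an orbit of the power lies in an orbit of T, and division with remainder splits an orbit of
  T into n orbits of the power, so a bound costs only a maximum or minimum over n starting vectors.
  The assumption that \<open>orbit_product\<close> is no unimodular constant enters exactly where
  the open mapping theorem needs a nonconstant function.\<close>

lemma subspace_closure:
  fixes W :: "'a::real_normed_vector set"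
  assumes "subspace W"
  shows "subspace (closure W)"
  unfolding subspace_def
proof (intro conjI ballI allI)
  show "0 \<in> closure W"
    using subspace_0[OF assms] closure_subset by blast
  show "x + y \<in> closure W" if xy: "x \<in> closure W" "y \<in> closure W" for x y
  proof -
    obtain u v where "\<And>n. u n \<in> W" "u \<longlonglongrightarrow> x" "\<And>n. v n \<in> W" "v \<longlonglongrightarrow> y"
      using xy unfolding closure_sequential by blast
    then show ?thesis
      unfolding closure_sequential
      by (intro exI[of _ "\<lambda>n. u n + v n"] conjI allI tendsto_add subspace_add[OF assms]) auto
  qed
  show "r *\<^sub>R x \<in> closure W" if x: "x \<in> closure W" for r x
  proof -
    obtain u where "\<And>n. u n \<in> W" "u \<longlonglongrightarrow> x"
      using x unfolding closure_sequential by blast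
    then show ?thesis
      unfolding closure_sequential
      by (intro exI[of _ "\<lambda>n. r *\<^sub>R u n"] conjI allI tendsto_scaleR[OF tendsto_const] subspace_scale[OF assms]) auto
  qed
qed

text \<open>A point outside \<open>W\<close> has a nearest point in \<open>W\<close>, since
  minimizing sequences are Cauchy by the parallelogram law; the difference of the two is orthogonal
  to \<open>W\<close>.\<close>

lemma closed_subspace_orthogonal:
  fixes W :: "'a::{real_inner, complete_space} set"
  assumes W: "subspace W" "closed W" "W \<noteq> UNIV"
  obtains g where "g \<noteq> 0" "\<And>w. w \<in> W \<Longrightarrow> inner g w = 0"
proof -
  obtain x where x: "x \<notin> W"
    using W by auto
  define D where "D = Inf ((\<lambda>w. (norm (x - w))\<^sup>2) ` W)"
  have bdd: "bdd_below ((\<lambda>w. (norm (x - w))\<^sup>2) ` W)"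
    by (rule bdd_belowI2[of _ 0]) auto
  have ne: "W \<noteq> {}"
    using subspace_0[OF W(1)] by auto
  have D_le: "D \<le> (norm (x - w))\<^sup>2" if "w \<in> W" for w
    unfolding D_def using that by (intro cINF_lower bdd)
  have "\<exists>w\<in>W. (norm (x - w))\<^sup>2 < D + 1 / Suc n" for n
    using cInf_lessD[of "(\<lambda>w. (norm (x - w))\<^sup>2) ` W" "D + 1 / Suc n"] ne unfolding D_def by auto
  then obtain w where w: "\<And>n. w n \<in> W" "\<And>n. (norm (x - w n))\<^sup>2 < D + 1 / Suc n"
    by metis
  have bound: "(norm (w m - w n))\<^sup>2 < 2 / Suc m + 2 / Suc n" for m n
  proof -
    have "(1/2) *\<^sub>R (w m + w n) \<in> W"
      using w by (intro subspace_scale subspace_add W)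
    then have "D \<le> (norm (x - (1/2) *\<^sub>R (w m + w n)))\<^sup>2"
      by (rule D_le)
    \<comment> \<open>Parallelogram law for \<open>x - w m\<close> and \<open>x - w n\<close>; the
      midpoint lies in \<open>W\<close>, so its squared distance to \<open>x\<close> is at least
      \<open>D\<close>.\<close>
    moreover have "(norm (w m - w n))\<^sup>2 + 4 * (norm (x - (1/2) *\<^sub>R (w m + w n)))\<^sup>2 =
       2 * (norm (x - w m))\<^sup>2 + 2 * (norm (x - w n))\<^sup>2"
      unfolding power2_norm_eq_inner by (simp add: algebra_simps inner_commute)
    ultimately show ?thesis
      using w(2)[of m] w(2)[of n] by linarith
  qed
  have "Cauchy w"
    unfolding Cauchy_altdef2
  proof (intro allI impI)
    fix e :: real
    assume "e > 0"
    then obtain N where N: "inverse (Suc N) < e\<^sup>2 / 4"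
      using reals_Archimedean[of "e\<^sup>2/4"] by auto
    have "dist (w n) (w N) < e" if "n \<ge> N" for n
    proof -
      have "1 / real (Suc n) \<le> 1 / real (Suc N)"
        using that by (intro divide_left_mono) auto
      then have "(norm (w n - w N))\<^sup>2 < e\<^sup>2"
        using bound[of n N] N unfolding inverse_eq_divide by linarith
      then show ?thesis
        using \<open>e > 0\<close> by (simp add: dist_norm power2_less_imp_less)
    qed
    then show "\<exists>N. \<forall>n\<ge>N. dist (w n) (w N) < e"
      by blast
  qed
  then obtain l where l: "w \<longlonglongrightarrow> l"
    using Cauchy_convergent_iff convergent_def by blast
  have lW: "l \<in> W"
    using closed_sequentially[OF W(2), of w l] w l by auto
  have "(\<lambda>n. (norm (x - w n))\<^sup>2) \<longlonglongrightarrow> (norm (x - l))\<^sup>2"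
    by (intro tendsto_intros l)
  moreover have "(\<lambda>n. D + 1 / Suc n) \<longlonglongrightarrow> D + 0"
    by (intro tendsto_intros LIMSEQ_Suc[OF lim_const_over_n])
  ultimately have le: "(norm (x - l))\<^sup>2 \<le> D"
    using w(2) by (intro LIMSEQ_le[of _ _ "\<lambda>n. D + 1 / Suc n"]) (auto intro: less_imp_le)
  have "inner (x - l) v = 0" if v: "v \<in> W" for v
  proof (cases "v = 0")
    case False
    \<comment> \<open>The multiple of \<open>v\<close> nearest to \<open>x - l\<close>: moving
      \<open>l\<close> by it would shorten the distance to \<open>x\<close> unless the inner product
      vanishes.\<close>
    define t where "t = inner (x - l) v / inner v v"
    have "l + t *\<^sub>R v \<in> W"
      using lW v by (intro subspace_add subspace_scale W)
    from D_le[OF this] le have "(norm (x - l))\<^sup>2 \<le> (norm ((x - l) - t *\<^sub>R v))\<^sup>2"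
      unfolding diff_diff_eq by (rule order.trans[rotated])
    also have "\<dots> = (norm (x - l))\<^sup>2 - 2 * t * inner (x - l) v + t\<^sup>2 * inner v v"
      unfolding power2_norm_eq_inner by (simp add: inner_diff_left inner_diff_right inner_commute algebra_simps power2_eq_square)
    also have "t\<^sup>2 * inner v v = t * inner (x - l) v"
      using False by (simp add: t_def power2_eq_square)
    finally have "t * inner (x - l) v \<le> 0"
      by simp
    then have "(inner (x - l) v)\<^sup>2 / inner v v \<le> 0"
      by (simp add: t_def power2_eq_square)
    moreover have "inner v v > 0"
      using False by simp
    ultimately show ?thesis
      by (simp add: divide_le_0_iff)
  qed auto
  moreover have "x - l \<noteq> 0"
    using x lW by auto
  ultimately show ?thesis
    using that by blast
qed

text \<open>
  Baire category: a vector \<open>x0 + u m\<close> close to \<open>x0\<close> is moved by the \<open>m\<close>-th power close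
  to \<open>y0\<close>, so the vectors whose orbit meets a given ball form a dense open set.
\<close>
lemma hypercyclicity_criterion:
  fixes S :: "'a::banach \<Rightarrow> 'a" and D :: "'a set"
  assumes S: "bounded_linear S"
    and D: "countable D" "closure D = UNIV"
    and X: "closure X = UNIV" "\<And>x. x \<in> X \<Longrightarrow> (\<lambda>m. (S ^^ m) x) \<longlonglongrightarrow> 0"
    and Y: "closure Y = UNIV" "\<And>y. y \<in> Y \<Longrightarrow> \<exists>u. u \<longlonglongrightarrow> 0 \<and> (\<forall>m. (S ^^ m) (u m) = y)"
  shows "\<exists>f. closure (range (\<lambda>m. (S ^^ m) f)) = UNIV"
proof -
  have S_pow: "bounded_linear (S ^^ m)" for m
  proof (induction m)
    case (Suc m)
    then show ?case
      using bounded_linear_compose[OF S Suc] by (simp add: o_def)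
  qed (simp add: bounded_linear_ident id_def)
  \<comment> \<open>A vector lying in \<open>G (d, j)\<close> for all \<open>d\<close> in
    \<open>D\<close> and all \<open>j\<close> has a dense orbit. As \<open>D\<close> is countable,
    only countably many dense open sets are intersected.\<close>
  define G where "G = (\<lambda>(d, j). \<Union>m. (S ^^ m) -` ball d (1 / Suc j))"
  have "open (G p)" for p
    unfolding G_def split_def
    by (intro open_UN ballI open_vimage open_ball linear_continuous_on S_pow)
  moreover have "closure (G p) = UNIV" for p
  proof -
    obtain d j where p: "p = (d, j)"
      by fastforce
    have "\<exists>x\<in>G p. dist x e < r" if r: "r > 0" for e r
    proof -
      obtain x0 where x0: "x0 \<in> X" "dist x0 e < r / 2"
        using X(1) closure_approachable[of e X] r by (metis UNIV_I half_gt_zero)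
      obtain y0 where y0: "y0 \<in> Y" "dist y0 d < 1 / Suc j"
        using Y(1) closure_approachable[of d Y] by (metis UNIV_I zero_less_divide_1_iff of_nat_0_less_iff zero_less_Suc)
      obtain u where u: "u \<longlonglongrightarrow> 0" "\<And>m. (S ^^ m) (u m) = y0"
        using Y(2)[OF y0(1)] by blast
      have "\<forall>\<^sub>F m in sequentially. norm (u m) < r / 2"
        using tendstoD[OF u(1), of "r/2"] r by simp
      \<comment> \<open>The bound is the slack that the choice of \<open>y0\<close> leaves in the
        ball around \<open>d\<close>; it is positive.\<close>
      moreover have "\<forall>\<^sub>F m in sequentially. norm ((S ^^ m) x0) < 1 / Suc j - dist y0 d"
        using tendstoD[OF X(2)[OF x0(1)], of "1 / Suc j - dist y0 d"] y0(2) by simp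
      ultimately obtain m where m: "norm (u m) < r / 2" "norm ((S ^^ m) x0) < 1 / Suc j - dist y0 d"
        using eventually_happens'[OF _ eventually_conj] by (metis (no_types, lifting) sequentially_bot)
      have "dist (x0 + u m) e \<le> dist x0 e + norm (u m)"
        using norm_triangle_ineq[of "x0 - e" "u m"] by (simp add: dist_norm algebra_simps)
      then have "dist (x0 + u m) e < r"
        using x0(2) m(1) by simp
      moreover have "dist d ((S ^^ m) (x0 + u m)) < 1 / Suc j"
      proof -
        have "(S ^^ m) (x0 + u m) = (S ^^ m) x0 + y0"
          using bounded_linear.linear[OF S_pow] u(2) by (simp add: linear_add)
        then have "dist d ((S ^^ m) (x0 + u m)) \<le> norm ((S ^^ m) x0) + dist y0 d"
          using norm_triangle_ineq[of "(S ^^ m) x0" "y0 - d"]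
          by (simp add: dist_norm algebra_simps norm_minus_commute)
        then show ?thesis
          using m(2) by simp
      qed
      ultimately show ?thesis
        unfolding p G_def by (intro bexI[of _ "x0 + u m"]) auto
    qed
    then show ?thesis
      by (auto simp: closure_approachable)
  qed
  ultimately have "Met_TC.mtopology closure_of \<Inter>(G ` (D \<times> UNIV)) = UNIV"
    using D(1) by (intro Met_TC.metric_Baire_category) (auto simp: complete_UNIV)
  then have "closure (\<Inter>(G ` (D \<times> UNIV))) = UNIV"
    by simp
  then obtain f where f: "f \<in> \<Inter>(G ` (D \<times> UNIV))"
    by (metis UNIV_not_empty closure_empty ex_in_conv)
  have "\<exists>m. dist ((S ^^ m) f) e < r" if r: "r > 0" for e r
  proof -
    obtain d where d: "d \<in> D" "dist d e < r / 2"
      using D(2) closure_approachable[of e D] r by (metis UNIV_I half_gt_zero)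
    obtain j where j: "inverse (Suc j) < r / 2"
      using reals_Archimedean[of "r / 2"] r by auto
    have "f \<in> G (d, j)"
      using f d(1) by auto
    then obtain m where "dist d ((S ^^ m) f) < 1 / Suc j"
      unfolding G_def by auto
    then have "dist ((S ^^ m) f) e < r"
      using j d(2) dist_triangle[of "(S ^^ m) f" e d] by (simp add: dist_commute inverse_eq_divide)
    then show ?thesis ..
  qed
  then have "closure (range (\<lambda>m. (S ^^ m) f)) = UNIV"
    by (auto simp: closure_approachable)
  then show ?thesis ..
qed

subsection \<open>Parseval's identity\<close>

lemma has_integral_cis:
  "((\<lambda>t. cis (2 * pi * of_int k * t)) has_integral (if k = 0 then 1 else 0)) {0..1}"
proof (cases "k = 0")
  case True
  then show ?thesis
    using has_integral_const_real[of "1::complex" 0 1] by simp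
next
  case False
  define c where "c = 2 * pi * of_int k"
  have c: "c \<noteq> 0"
    using False by (simp add: c_def)
  have "((\<lambda>t. cis (c * t)) has_integral (cis (c * 1) / (\<i> * c) - cis (c * 0) / (\<i> * c))) {0..1}"
  proof (rule fundamental_theorem_of_calculus)
    fix x :: real
    show "((\<lambda>t. cis (c * t) / (\<i> * c)) has_vector_derivative cis (c * x)) (at x within {0..1})"
    proof -
      have "((\<lambda>z. exp (\<i> * c * z) / (\<i> * c)) has_field_derivative exp (\<i> * c * of_real x)) (at (of_real x))"
        using c by (auto intro!: derivative_eq_intros)
      then have "((\<lambda>t. exp (\<i> * c * of_real t) / (\<i> * c)) has_vector_derivative exp (\<i> * c * of_real x))
          (at x within {0..1})"
        by (rule has_vector_derivative_real_field)
      then show ?thesis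
        by (simp add: cis_conv_exp mult.assoc)
    qed
  qed auto
  moreover have "cis (c * 1) = 1"
    unfolding c_def by (simp add: cis_multiple_2pi)
  ultimately show ?thesis
    using False by (simp add: c_def)
qed

text \<open>The squared modulus expands into a double sum of exponentials, of which only the
  diagonal survives integration over a full period.\<close>

lemma parseval_finite:
  fixes a :: "nat \<Rightarrow> complex"
  shows "((\<lambda>t. (cmod (\<Sum>n<N. a n * cis (2 * pi * of_int n * t)))\<^sup>2) has_integral
           (\<Sum>n<N. (cmod (a n))\<^sup>2)) {0..1}"
proof -
  have "((\<lambda>t. \<Sum>n<N. \<Sum>m<N. (a n * cnj (a m)) * cis (2 * pi * of_int (int n - int m) * t)) has_integral
         (\<Sum>n<N. \<Sum>m<N. (a n * cnj (a m)) * (if int n - int m = 0 then 1 else 0))) {0..1}"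
    by (intro has_integral_sum has_integral_mult_right has_integral_cis) auto
  also have "(\<Sum>n<N. \<Sum>m<N. (a n * cnj (a m)) * (if int n - int m = 0 then 1 else 0)) =
     of_real (\<Sum>n<N. (cmod (a n))\<^sup>2)"
    by (simp add: if_distrib[of "\<lambda>x. _ * x"] sum.delta flip: complex_norm_square cong: if_cong)
  also have "(\<lambda>t. \<Sum>n<N. \<Sum>m<N. (a n * cnj (a m)) * cis (2 * pi * of_int (int n - int m) * t)) =
     (\<lambda>t. of_real ((cmod (\<Sum>n<N. a n * cis (2 * pi * of_int n * t)))\<^sup>2))"
  proof
    fix t :: real
    have "cis (2 * pi * of_int (int n - int m) * t) =
        cis (2 * pi * of_int n * t) * cnj (cis (2 * pi * of_int m * t))" for n m
      by (simp add: cis_cnj cis_mult algebra_simps)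
    then show "(\<Sum>n<N. \<Sum>m<N. (a n * cnj (a m)) * cis (2 * pi * of_int (int n - int m) * t)) =
        of_real ((cmod (\<Sum>n<N. a n * cis (2 * pi * of_int n * t)))\<^sup>2)"
      unfolding complex_norm_square cnj_sum sum_product
      by (intro sum.cong refl) (simp only: complex_cnj_mult mult_ac)
  qed
  finally have "((\<lambda>t. complex_of_real ((cmod (\<Sum>n<N. a n * cis (2 * pi * of_int n * t)))\<^sup>2)) has_integral
      of_real (\<Sum>n<N. (cmod (a n))\<^sup>2)) {0..1}" .
  from has_integral_linear[OF this bounded_linear_Re] show ?thesis
    by (simp only: o_def Re_complex_of_real)
qed

text \<open>The sum of the moduli bounds all partial sums uniformly in \<open>t\<close>, so
  dominated convergence carries the finite identity to the limit and yields square summability along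
  the way.\<close>

lemma parseval:
  fixes a :: "nat \<Rightarrow> complex"
  assumes a: "summable (\<lambda>n. cmod (a n))"
  shows "summable (\<lambda>n. (cmod (a n))\<^sup>2)"
    and "((\<lambda>t. (cmod (\<Sum>n. a n * cis (2 * pi * of_int n * t)))\<^sup>2) has_integral
           (\<Sum>n. (cmod (a n))\<^sup>2)) {0..1}"
proof -
  define F where "F = (\<lambda>t. (cmod (\<Sum>n. a n * cis (2 * pi * of_int n * t)))\<^sup>2)"
  define P where "P = (\<lambda>N t. (cmod (\<Sum>n<N. a n * cis (2 * pi * of_int n * t)))\<^sup>2)"
  have P: "(P N has_integral (\<Sum>n<N. (cmod (a n))\<^sup>2)) {0..1}" for N
    unfolding P_def by (rule parseval_finite)
  have P_le: "norm (P N t) \<le> (\<Sum>n. cmod (a n))\<^sup>2" for N t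
  proof -
    have "cmod (\<Sum>n<N. a n * cis (2 * pi * of_int n * t)) \<le> (\<Sum>n<N. cmod (a n))"
      by (rule order.trans[OF norm_sum]) (simp add: norm_mult)
    also have "\<dots> \<le> (\<Sum>n. cmod (a n))"
      by (intro sum_le_suminf a) auto
    finally show ?thesis
      by (simp add: P_def power_mono)
  qed
  have lim: "(\<lambda>N. P N t) \<longlonglongrightarrow> F t" for t
  proof -
    have "summable (\<lambda>n. a n * cis (2 * pi * of_int n * t))"
      by (rule summable_norm_cancel) (simp add: norm_mult a)
    then show ?thesis
      unfolding P_def F_def by (intro tendsto_intros summable_LIMSEQ)
  qed
  have F: "F integrable_on {0..1}" "(\<lambda>N. integral {0..1} (P N)) \<longlonglongrightarrow> integral {0..1} F"
    using dominated_convergence[of P "{0..1}" "\<lambda>_. (\<Sum>n. cmod (a n))\<^sup>2" F] P P_le lim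
    by (auto simp: has_integral_integrable)
  then have sums: "(\<lambda>n. (cmod (a n))\<^sup>2) sums integral {0..1} F"
    using integral_unique[OF P] by (simp add: sums_def)
  then show "summable (\<lambda>n. (cmod (a n))\<^sup>2)"
    by (rule sums_summable)
  show "((\<lambda>t. (cmod (\<Sum>n. a n * cis (2 * pi * of_int n * t)))\<^sup>2) has_integral
           (\<Sum>n. (cmod (a n))\<^sup>2)) {0..1}"
    using F(1) sums_unique[OF sums] by (simp add: F_def has_integral_integral)
qed

subsection \<open>The Hardy space as a Hilbert space of coefficient sequences\<close>

lemma hfun_zero [simp]: "hfun 0 z = 0"
  unfolding zero_hardy2_def by (subst Abs_hardy2_inverse) (auto intro: hardy2_set_zero)

lemma hfun_add [simp]: "hfun (f + g) z = hfun f z + hfun g z"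
  unfolding plus_hardy2_def by (subst Abs_hardy2_inverse) (auto intro: hardy2_set_add hfun)

lemma hcoeff_zero [simp]: "hcoeff 0 n = 0"
proof -
  have "hfun 0 = (\<lambda>_. 0)"
    by auto
  then show ?thesis
    by (simp add: hcoeff_def)
qed

lemma hcoeff_add [simp]: "hcoeff (f + g) n = hcoeff f n + hcoeff g n"
proof -
  have "hfun (f + g) = (\<lambda>z. hfun f z + hfun g z)"
    by auto
  then show ?thesis
    by (simp add: hcoeff_def taylor_coeff_add hfun_holomorphic)
qed

declare hcoeff_hscale [simp]

lemma hcoeff_uminus [simp]: "hcoeff (- f) n = - hcoeff f n"
  by (simp add: uminus_hardy2_def)

lemma hcoeff_diff [simp]: "hcoeff (f - g) n = hcoeff f n - hcoeff g n"
  by (simp only: minus_hardy2_def hcoeff_add hcoeff_uminus) simp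

lemma hcoeff_scaleR [simp]: "hcoeff (scaleR r f) n = of_real r * hcoeff f n"
  by (simp add: scaleR_hardy2_def)

lemma hcoeff_sum [simp]: "hcoeff (\<Sum>i\<in>I. f i) n = (\<Sum>i\<in>I. hcoeff (f i) n)"
  by (induction I rule: infinite_finite_induct) auto

lemma hardy2_eqI:
  assumes "\<And>n. hcoeff f n = hcoeff g n"
  shows "f = g"
proof -
  have "hfun (f - g) = (\<lambda>_. 0)"
    by (rule hardy2_set_eq_zero[OF hfun]) (simp add: assms flip: hcoeff_def)
  then have "f - g = 0"
    by (metis hfun_inject hfun_zero ext)
  then show ?thesis
    by simp
qed

lemma hinner_add_left: "hinner (f + g) h = hinner f h + hinner g h"
  unfolding hinner_def by (simp add: suminf_add summable_hinner ring_distribs)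

lemma hinner_diff_left: "hinner (f - g) h = hinner f h - hinner g h"
  unfolding hinner_def by (simp add: suminf_diff summable_hinner ring_distribs)

lemma hinner_hscale_left: "hinner (hscale c f) h = c * hinner f h"
  unfolding hinner_def by (simp add: suminf_mult summable_hinner mult.assoc)

lemma hinner_commute: "hinner f g = cnj (hinner g f)"
proof -
  have "cnj (hinner g f) = (\<Sum>n. cnj (hcoeff g n * cnj (hcoeff f n)))"
    unfolding hinner_def using summable_hinner[of g f]
    by (metis bounded_linear.suminf bounded_linear_cnj)
  then show ?thesis
    by (simp add: hinner_def mult.commute)
qed

lemma norm_hardy2_square_sums: "(\<lambda>n. (cmod (hcoeff f n))\<^sup>2) sums (norm f)\<^sup>2"
proof -
  have "(\<lambda>n. Re (hcoeff f n * cnj (hcoeff f n))) sums inner f f"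
    unfolding inner_hardy2_def hinner_def by (intro sums_Re summable_sums summable_hinner)
  then show ?thesis
    by (simp only: power2_norm_eq_inner complex_norm_square[symmetric] Re_complex_of_real)
qed

lemma norm_hardy2_square: "(norm f)\<^sup>2 = (\<Sum>n. (cmod (hcoeff f n))\<^sup>2)"
  by (rule sums_unique[OF norm_hardy2_square_sums])

lemma norm_hardy2_leI:
  assumes "\<And>N. (\<Sum>n<N. (cmod (hcoeff f n))\<^sup>2) \<le> C\<^sup>2" "C \<ge> 0"
  shows "norm f \<le> C"
proof -
  have "(norm f)\<^sup>2 \<le> C\<^sup>2"
    unfolding norm_hardy2_square by (intro suminf_le_const summable_hcoeff assms)
  then show ?thesis
    using assms(2) by (rule power2_le_imp_le)
qed

lemma sum_hcoeff_square_le: "finite A \<Longrightarrow> (\<Sum>n\<in>A. (cmod (hcoeff f n))\<^sup>2) \<le> (norm f)\<^sup>2"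
  unfolding norm_hardy2_square by (intro sum_le_suminf summable_hcoeff) auto

lemma cmod_hcoeff_le: "cmod (hcoeff f n) \<le> norm f"
  using sum_hcoeff_square_le[of "{n}" f] by (simp add: abs_le_square_iff[symmetric])

lemma norm_hscale [simp]: "norm (hscale c f) = cmod c * norm f"
proof -
  have "(norm (hscale c f))\<^sup>2 = (cmod c * norm f)\<^sup>2"
    unfolding norm_hardy2_square power_mult_distrib
    by (simp add: norm_mult power_mult_distrib suminf_mult summable_hcoeff)
  then show ?thesis
    by (simp add: power2_eq_iff_nonneg)
qed

text \<open>The Cauchy-Schwarz inequality of the real inner product only controls the real part.
  Rotating \<open>f\<close> by the unimodular \<open>c\<close> turns the complex product into its
  modulus, so nothing is lost.\<close>

lemma cmod_hinner_le: "cmod (hinner f g) \<le> norm f * norm g"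
proof (cases "hinner f g = 0")
  case False
  define c where "c = cnj (hinner f g) / cmod (hinner f g)"
  have c: "cmod c = 1"
    using False by (simp add: c_def norm_divide)
  have "c * hinner f g = of_real ((cmod (hinner f g))\<^sup>2) / of_real (cmod (hinner f g))"
    by (simp only: c_def complex_norm_square times_divide_eq_left mult.commute[of "hinner f g"])
  then have c_mult: "c * hinner f g = of_real (cmod (hinner f g))"
    using False by (simp add: power2_eq_square)
  have "cmod (hinner f g) = inner (hscale c f) g"
    by (simp add: inner_hardy2_def hinner_hscale_left c_mult)
  also have "\<dots> \<le> norm (hscale c f) * norm g"
    by (rule norm_cauchy_schwarz)
  finally show ?thesis
    by (simp add: c)
qed auto

lemma bounded_linear_hinner_left: "bounded_linear (\<lambda>f. hinner f g)"
proof (rule bounded_linear_intro)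
  show "hinner (r *\<^sub>R f) g = r *\<^sub>R hinner f g" for r f
    by (simp add: scaleR_hardy2_def hinner_hscale_left scaleR_conv_of_real)
qed (rule hinner_add_left cmod_hinner_le)+

lemma hfun_sums:
  assumes "z \<in> unit_disc"
  shows "(\<lambda>n. hcoeff f n * z ^ n) sums hfun f z"
  using holomorphic_power_series[OF hfun_holomorphic assms, of f] by (simp add: hcoeff_def taylor_coeff_def)

text \<open>Cauchy-Schwarz against a geometric sequence makes the power series converge in the disc.
  Limits, adjoints, rotations and kernels are all constructed from their coefficients in this
  way.\<close>

lemma ex_hardy2_hcoeff:
  assumes "summable (\<lambda>n. (cmod (a n))\<^sup>2)"
  shows "\<exists>f. hcoeff f = a"
proof -
  define F where "F = (\<lambda>z. if z \<in> unit_disc then \<Sum>n. a n * z ^ n else 0)"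
  have sums: "(\<lambda>n. a n * z ^ n) sums F z" if z: "z \<in> unit_disc" for z
  proof -
    \<comment> \<open>This is the power series at \<open>z\<close>, with a double conjugation to fit
      the form of \<open>summable_square_mult\<close>.\<close>
    have "summable (\<lambda>n. a n * cnj (cnj z ^ n))"
    proof (rule summable_square_mult[OF assms])
      have "summable (\<lambda>n. ((cmod z)\<^sup>2) ^ n)"
        using z by (intro summable_geometric) (simp add: abs_square_less_1)
      then show "summable (\<lambda>n. (cmod (cnj z ^ n))\<^sup>2)"
        by (simp add: norm_power flip: power_mult) (simp add: mult.commute)
    qed
    then show ?thesis
      using z by (simp add: F_def summable_sums)
  qed
  have hol: "F holomorphic_on unit_disc"
    using sums by (intro power_series_holomorphic[of 0 1 a]) auto
  have "F has_fps_expansion Abs_fps a"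
  proof (rule has_fps_expansionI)
    have "\<forall>\<^sub>F z in nhds 0. z \<in> unit_disc"
      by (rule eventually_nhds_in_open) auto
    then show "\<forall>\<^sub>F u in nhds 0. (\<lambda>n. fps_nth (Abs_fps a) n * u ^ n) sums F u"
      by eventually_elim (simp add: sums)
  qed
  from fps_nth_fps_expansion[OF this] have coeff: "taylor_coeff F = a"
    by (auto simp: taylor_coeff_def)
  have "F \<in> hardy2_set"
    using hol assms by (simp add: hardy2_set_def coeff) (simp add: F_def)
  then have "hfun (Abs_hardy2 F) = F"
    by (rule Abs_hardy2_inverse)
  then have "hcoeff (Abs_hardy2 F) = a"
    by (auto simp: hcoeff_def coeff)
  then show ?thesis ..
qed

text \<open>The completeness proof for square-summable sequences: coefficients converge one by one,
  and bounds on finite partial sums survive the limit.\<close>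

instance hardy2 :: banach
proof
  fix X :: "nat \<Rightarrow> hardy2"
  assume X: "Cauchy X"
  have "Cauchy (\<lambda>m. hcoeff (X m) n)" for n
  proof (rule CauchyI)
    fix e :: real
    assume "e > 0"
    then obtain M where M: "\<forall>m\<ge>M. \<forall>k\<ge>M. norm (X m - X k) < e"
      using CauchyD[OF X] by blast
    have "norm (hcoeff (X m) n - hcoeff (X k) n) < e" if "m \<ge> M" "k \<ge> M" for m k
      using M that cmod_hcoeff_le[of "X m - X k" n] by fastforce
    then show "\<exists>M. \<forall>m\<ge>M. \<forall>k\<ge>M. norm (hcoeff (X m) n - hcoeff (X k) n) < e"
      by blast
  qed
  then have "\<exists>l. (\<lambda>m. hcoeff (X m) n) \<longlonglongrightarrow> l" for n
    using Cauchy_convergent_iff convergent_def by blast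
  then obtain a where a: "\<And>n. (\<lambda>m. hcoeff (X m) n) \<longlonglongrightarrow> a n"
    by metis
  have tail: "(\<Sum>n<N. (cmod (hcoeff (X k) n - a n))\<^sup>2) \<le> e\<^sup>2"
    if M: "\<forall>m\<ge>M. \<forall>k\<ge>M. norm (X m - X k) < e" and k: "k \<ge> M" for M k N and e :: real
  proof (rule LIMSEQ_le_const2)
    show "(\<lambda>m. \<Sum>n<N. (cmod (hcoeff (X k) n - hcoeff (X m) n))\<^sup>2) \<longlonglongrightarrow> (\<Sum>n<N. (cmod (hcoeff (X k) n - a n))\<^sup>2)"
      by (intro tendsto_intros a)
    have "(\<Sum>n<N. (cmod (hcoeff (X k) n - hcoeff (X m) n))\<^sup>2) \<le> e\<^sup>2" if "m \<ge> M" for m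
    proof -
      have "(\<Sum>n<N. (cmod (hcoeff (X k) n - hcoeff (X m) n))\<^sup>2) \<le> (norm (X k - X m))\<^sup>2"
        using sum_hcoeff_square_le[of "{..<N}" "X k - X m"] by simp
      also have "\<dots> \<le> e\<^sup>2"
        using M k that by (intro power_mono) (auto intro: less_imp_le)
      finally show ?thesis .
    qed
    then show "\<exists>M. \<forall>m\<ge>M. (\<Sum>n<N. (cmod (hcoeff (X k) n - hcoeff (X m) n))\<^sup>2) \<le> e\<^sup>2"
      by blast
  qed
  obtain M1 where M1: "\<forall>m\<ge>M1. \<forall>k\<ge>M1. norm (X m - X k) < 1"
    using CauchyD[OF X, of 1] by auto
  have "summable (\<lambda>n. (cmod (hcoeff (X M1) n - a n))\<^sup>2)"
    by (rule summableI_nonneg_bounded[of _ 1]) (use tail[OF M1, of M1] in auto)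
  \<comment> \<open>The summand is the squared modulus of \<open>a n\<close>, written as a
    coefficient of \<open>X M1\<close> minus the square-summable difference.\<close>
  then have "summable (\<lambda>n. (cmod (hcoeff (X M1) n + - (hcoeff (X M1) n - a n)))\<^sup>2)"
    by (intro summable_square_add summable_hcoeff) (simp only: norm_minus_cancel)
  then obtain f where f: "hcoeff f = a"
    using ex_hardy2_hcoeff[of a] by auto
  have "X \<longlonglongrightarrow> f"
  proof (rule LIMSEQ_I)
    fix r :: real
    assume "r > 0"
    then obtain M where M: "\<forall>m\<ge>M. \<forall>k\<ge>M. norm (X m - X k) < r / 2"
      using CauchyD[OF X, of "r / 2"] by auto
    have "norm (X k - f) < r" if "k \<ge> M" for k
    proof -
      have "norm (X k - f) \<le> r / 2"
        using tail[OF M that] \<open>r > 0\<close> by (intro norm_hardy2_leI) (simp_all add: f)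
      then show ?thesis
        using \<open>r > 0\<close> by simp
    qed
    then show "\<exists>no. \<forall>n\<ge>no. norm (X n - f) < r"
      by blast
  qed
  then show "convergent X"
    by (rule convergentI)
qed

lemma hardy2_eqI_hfun:
  assumes "\<And>z. z \<in> unit_disc \<Longrightarrow> hfun f z = hfun g z"
  shows "f = g"
proof -
  have "hfun f z = hfun g z" for z
    using assms hfun[of f] hfun[of g] by (cases "z \<in> unit_disc") (auto simp: hardy2_set_def)
  then show ?thesis
    by (metis ext hfun_inject)
qed

lemma h2_of_eqI:
  assumes "\<And>z. z \<in> unit_disc \<Longrightarrow> f z = hfun F z"
  shows "h2_of f = F"
proof -
  have "(\<lambda>z. if z \<in> unit_disc then f z else 0) = hfun F"
    using assms hfun[of F] by (auto simp: hardy2_set_def)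
  then show ?thesis
    by (simp add: h2_of_def hfun_inverse)
qed

subsection \<open>Multiplication operators and the functional calculus of the backward shift\<close>

text \<open>Convergence of the Taylor series at some \<open>s\<close> between \<open>r\<close> and 1
  gives absolute convergence at radius \<open>r\<close>, which is what \<open>parseval\<close>
  requires.\<close>

lemma parseval_circle:
  assumes g: "g holomorphic_on unit_disc" and r: "0 \<le> r" "r < 1"
  shows "summable (\<lambda>n. (cmod (taylor_coeff g n) * r ^ n)\<^sup>2)"
    and "((\<lambda>t. (cmod (g (of_real r * cis (2 * pi * t))))\<^sup>2) has_integral
           (\<Sum>n. (cmod (taylor_coeff g n) * r ^ n)\<^sup>2)) {0..1}"
proof -
  have sums: "(\<lambda>n. taylor_coeff g n * z ^ n) sums g z" if "z \<in> unit_disc" for z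
    using holomorphic_power_series[OF g that] by (simp add: taylor_coeff_def)
  obtain s where s: "r < s" "s < 1"
    using r dense by blast
  define a where "a = (\<lambda>n. taylor_coeff g n * of_real r ^ n)"
  have norm_a: "cmod (a n) = cmod (taylor_coeff g n) * r ^ n" for n
    using r by (simp add: a_def norm_mult norm_power)
  have "summable (\<lambda>n. cmod (a n))"
    unfolding a_def
    by (rule powser_insidea[of _ "of_real s"]) (use s r in \<open>auto intro!: sums_summable[OF sums]\<close>)
  note parseval[OF this]
  moreover have "(\<Sum>n. a n * cis (2 * pi * of_int n * t)) = g (of_real r * cis (2 * pi * t))" for t
  proof -
    have "of_real r * cis (2 * pi * t) \<in> unit_disc"
      using r by (simp add: norm_mult)
    from sums[OF this] have "(\<lambda>n. a n * cis (2 * pi * of_int n * t)) sums g (of_real r * cis (2 * pi * t))"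
      by (simp add: a_def power_mult_distrib Complex.DeMoivre mult.assoc mult.left_commute[of _ "of_nat _"])
    then show ?thesis
      by (rule sums_unique[symmetric])
  qed
  ultimately show "summable (\<lambda>n. (cmod (taylor_coeff g n) * r ^ n)\<^sup>2)"
    and "((\<lambda>t. (cmod (g (of_real r * cis (2 * pi * t))))\<^sup>2) has_integral
           (\<Sum>n. (cmod (taylor_coeff g n) * r ^ n)\<^sup>2)) {0..1}"
    by (simp_all add: norm_a)
qed

text \<open>
  Parseval on the circles of radius \<open>r < 1\<close> turns the pointwise bound on \<open>\<psi>\<close> into a bound on
  coefficients, uniformly in \<open>r\<close>.
\<close>
lemma
  assumes hol: "\<psi> holomorphic_on unit_disc" and C: "\<And>z. z \<in> unit_disc \<Longrightarrow> cmod (\<psi> z) \<le> C"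
  shows hfun_mult_operator: "z \<in> unit_disc \<Longrightarrow> hfun (mult_operator \<psi> f) z = \<psi> z * hfun f z"
    and norm_mult_operator_le: "norm (mult_operator \<psi> f) \<le> C * norm f"
proof -
  \<comment> \<open>\<open>mult_operator\<close> passes through \<open>Abs_hardy2\<close>, so its
    values are known only once this cut-off product is shown to belong to
    \<open>hardy2_set\<close>.\<close>
  define F where "F = (\<lambda>z. if z \<in> unit_disc then \<psi> z * hfun f z else 0)"
  have "0 \<le> cmod (\<psi> 0)"
    by simp
  also have "\<dots> \<le> C"
    by (rule C) simp
  finally have C0: "C \<ge> 0" .
  have holF: "F holomorphic_on unit_disc"
    by (rule holomorphic_transform[of "\<lambda>z. \<psi> z * hfun f z"])
       (auto simp: F_def intro!: holomorphic_intros hol hfun_holomorphic)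
  have circle: "(\<Sum>n<N. (cmod (taylor_coeff F n) * r ^ n)\<^sup>2) \<le> (C * norm f)\<^sup>2"
    if r: "0 \<le> r" "r < 1" for r N
  proof -
    have "(\<Sum>n<N. (cmod (taylor_coeff F n) * r ^ n)\<^sup>2) \<le> (\<Sum>n. (cmod (taylor_coeff F n) * r ^ n)\<^sup>2)"
      by (intro sum_le_suminf parseval_circle holF r) auto
    also have "\<dots> \<le> C\<^sup>2 * (\<Sum>n. (cmod (hcoeff f n) * r ^ n)\<^sup>2)"
      unfolding hcoeff_def
    proof (rule has_integral_le[OF parseval_circle(2)[OF holF r]
            has_integral_mult_right[OF parseval_circle(2)[OF hfun_holomorphic r]]])
      fix t :: real
      have disc: "of_real r * cis (2 * pi * t) \<in> unit_disc"
        using r by (simp add: norm_mult)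
      then have "cmod (F (of_real r * cis (2 * pi * t))) \<le> C * cmod (hfun f (of_real r * cis (2 * pi * t)))"
        by (simp add: F_def norm_mult mult_right_mono C)
      then show "(cmod (F (of_real r * cis (2 * pi * t))))\<^sup>2 \<le> C\<^sup>2 * (cmod (hfun f (of_real r * cis (2 * pi * t))))\<^sup>2"
        unfolding power_mult_distrib[symmetric] by (intro power_mono) auto
    qed
    also have "\<dots> \<le> C\<^sup>2 * (norm f)\<^sup>2"
    proof (intro mult_left_mono)
      show "(\<Sum>n. (cmod (hcoeff f n) * r ^ n)\<^sup>2) \<le> (norm f)\<^sup>2"
        unfolding norm_hardy2_square
      proof (intro suminf_le summable_hcoeff)
        show "summable (\<lambda>n. (cmod (hcoeff f n) * r ^ n)\<^sup>2)"
          unfolding hcoeff_def by (rule parseval_circle(1)[OF hfun_holomorphic r])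
        show "(cmod (hcoeff f n) * r ^ n)\<^sup>2 \<le> (cmod (hcoeff f n))\<^sup>2" for n
          using r by (intro power_mono mult_left_le power_le_one) auto
      qed
    qed auto
    finally show ?thesis
      by (simp add: power_mult_distrib)
  qed
  \<comment> \<open>The radii k / (k + 1) tend to 1; for fixed \<open>N\<close> the sum is finite,
    so the limit can be taken termwise.\<close>
  have bound: "(\<Sum>n<N. (cmod (taylor_coeff F n))\<^sup>2) \<le> (C * norm f)\<^sup>2" for N
  proof (rule LIMSEQ_le_const2)
    have "(\<lambda>k. \<Sum>n<N. (cmod (taylor_coeff F n) * (real k / real (Suc k)) ^ n)\<^sup>2)
            \<longlonglongrightarrow> (\<Sum>n<N. (cmod (taylor_coeff F n) * 1 ^ n)\<^sup>2)"
      by (intro tendsto_intros LIMSEQ_n_over_Suc_n)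
    then show "(\<lambda>k. \<Sum>n<N. (cmod (taylor_coeff F n) * (real k / real (Suc k)) ^ n)\<^sup>2)
            \<longlonglongrightarrow> (\<Sum>n<N. (cmod (taylor_coeff F n))\<^sup>2)"
      by simp
    show "\<exists>K. \<forall>k\<ge>K. (\<Sum>n<N. (cmod (taylor_coeff F n) * (real k / real (Suc k)) ^ n)\<^sup>2) \<le> (C * norm f)\<^sup>2"
      by (intro exI allI impI circle) auto
  qed
  have "summable (\<lambda>n. (cmod (taylor_coeff F n))\<^sup>2)"
    using bound by (intro summableI_nonneg_bounded) auto
  then have "F \<in> hardy2_set"
    using holF by (simp add: hardy2_set_def) (simp add: F_def)
  then have F: "hfun (mult_operator \<psi> f) = F"
    unfolding mult_operator_def h2_of_def F_def by (rule Abs_hardy2_inverse)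
  show "z \<in> unit_disc \<Longrightarrow> hfun (mult_operator \<psi> f) z = \<psi> z * hfun f z"
    by (simp add: F F_def)
  show "norm (mult_operator \<psi> f) \<le> C * norm f"
    using bound C0 by (intro norm_hardy2_leI) (simp_all add: hcoeff_def F)
qed

lemma h_infinityE:
  assumes "\<psi> \<in> h_infinity"
  obtains C where "C > 0" "\<And>z. z \<in> unit_disc \<Longrightarrow> cmod (\<psi> z) \<le> C"
  using assms unfolding h_infinity_def bounded_pos by blast

lemma hfun_mult_operator_h_infinity:
  assumes "\<psi> \<in> h_infinity" "z \<in> unit_disc"
  shows "hfun (mult_operator \<psi> f) z = \<psi> z * hfun f z"
  using assms hfun_mult_operator h_infinityE[OF assms(1)] by (metis (no_types, lifting) h_infinity_def mem_Collect_eq)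

lemma bounded_operator_mult_operator:
  assumes "\<psi> \<in> h_infinity"
  shows "bounded_operator (mult_operator \<psi>)"
  unfolding bounded_operator_def
proof (intro conjI allI)
  obtain C where C: "\<And>z. z \<in> unit_disc \<Longrightarrow> cmod (\<psi> z) \<le> C"
    using h_infinityE[OF assms] by blast
  have hol: "\<psi> holomorphic_on unit_disc"
    using assms by (simp add: h_infinity_def)
  show scale: "mult_operator \<psi> (hscale c f) = hscale c (mult_operator \<psi> f)" for c f
    by (rule hardy2_eqI_hfun) (simp add: hfun_mult_operator_h_infinity[OF assms] hfun_hscale)
  show "bounded_linear (mult_operator \<psi>)"
  proof (rule bounded_linear_intro)
    show "mult_operator \<psi> (f + g) = mult_operator \<psi> f + mult_operator \<psi> g" for f g
      by (rule hardy2_eqI_hfun) (simp add: hfun_mult_operator_h_infinity[OF assms] ring_distribs)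
    show "mult_operator \<psi> (r *\<^sub>R f) = r *\<^sub>R mult_operator \<psi> f" for r f
      by (simp add: scaleR_hardy2_def scale)
    show "norm (mult_operator \<psi> f) \<le> norm f * C" for f
      using norm_mult_operator_le[OF hol C] by (simp add: mult.commute)
  qed
qed

section \<open>Polynomial approximation and existence of adjoints\<close>

lemma hcoeff_monom [simp]: "hcoeff (h2_of (\<lambda>z. z ^ n)) k = (if k = n then 1 else 0)"
  unfolding hcoeff_def hfun_h2_of_monom taylor_coeff_monom ..

definition htrunc :: "nat \<Rightarrow> hardy2 \<Rightarrow> hardy2" where
  "htrunc N f = (\<Sum>n<N. hscale (hcoeff f n) (h2_of (\<lambda>z. z ^ n)))"

lemma hcoeff_htrunc: "hcoeff (htrunc N f) k = (if k < N then hcoeff f k else 0)"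
  by (simp add: htrunc_def if_distrib[of "\<lambda>x. _ * x"] cong: if_cong)

text \<open>By Pythagoras the squared error is the squared norm of \<open>f\<close> minus a partial
  sum of its series.\<close>

lemma htrunc_tendsto: "(\<lambda>N. htrunc N f) \<longlonglongrightarrow> f"
proof -
  have "(norm (f - htrunc N f))\<^sup>2 = (norm f)\<^sup>2 - (\<Sum>n<N. (cmod (hcoeff f n))\<^sup>2)" for N
  proof -
    have "(\<lambda>n. (cmod (hcoeff (f - htrunc N f) n))\<^sup>2) =
        (\<lambda>n. (cmod (hcoeff f n))\<^sup>2 - (if n < N then (cmod (hcoeff f n))\<^sup>2 else 0))"
      by (auto simp: hcoeff_htrunc)
    moreover have "(\<lambda>n. if n \<in> {..<N} then (cmod (hcoeff f n))\<^sup>2 else 0) sums (\<Sum>n<N. (cmod (hcoeff f n))\<^sup>2)"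
      by (rule sums_If_finite_set) auto
    ultimately have "(\<lambda>n. (cmod (hcoeff (f - htrunc N f) n))\<^sup>2) sums
        ((norm f)\<^sup>2 - (\<Sum>n<N. (cmod (hcoeff f n))\<^sup>2))"
      by (simp only: lessThan_iff sums_diff norm_hardy2_square_sums)
    then show ?thesis
      using norm_hardy2_square_sums sums_unique2 by blast
  qed
  moreover have "(\<lambda>N. (norm f)\<^sup>2 - (\<Sum>n<N. (cmod (hcoeff f n))\<^sup>2)) \<longlonglongrightarrow> (norm f)\<^sup>2 - (norm f)\<^sup>2"
    using norm_hardy2_square_sums[of f] by (intro tendsto_intros) (simp add: sums_def)
  ultimately have "(\<lambda>N. (norm (f - htrunc N f))\<^sup>2) \<longlonglongrightarrow> 0"
    by simp
  then have "(\<lambda>N. norm (f - htrunc N f)) \<longlonglongrightarrow> 0"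
    by (simp only: power_tendsto_0_iff zero_less_numeral)
  then show ?thesis
    by (simp only: norm_minus_commute[of f] tendsto_norm_zero_iff LIM_zero_iff)
qed

lemma hinner_hscale_right: "hinner f (hscale c g) = cnj c * hinner f g"
  by (metis complex_cnj_mult hinner_commute hinner_hscale_left)

lemma hinner_diff_right: "hinner f (g - h) = hinner f g - hinner f h"
  by (metis complex_cnj_diff hinner_commute hinner_diff_left)

lemma hinner_add_right: "hinner f (g + h) = hinner f g + hinner f h"
  by (metis complex_cnj_add hinner_commute hinner_add_left)

lemma hinner_sum_left: "hinner (\<Sum>i\<in>I. F i) g = (\<Sum>i\<in>I. hinner (F i) g)"
  by (rule linear_sum[OF bounded_linear.linear[OF bounded_linear_hinner_left]])

lemma hinner_right_eqI:
  assumes "\<And>f. hinner f g = hinner f h"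
  shows "g = h"
proof -
  have "inner (g - h) (g - h) = 0"
    by (simp add: inner_hardy2_def hinner_diff_right assms)
  then show ?thesis
    by simp
qed

text \<open>Riesz representation in coordinates: testing on monomials forces the coefficients
  \<open>b\<close> of the representing vector, boundedness of \<open>M\<close> makes them
  square-summable, and truncation extends the identity from polynomials to all
  \<open>f\<close>.\<close>

lemma ex_hadjoint:
  assumes M: "bounded_operator M"
  shows "\<exists>A. \<forall>f g. hinner (M f) g = hinner f (A g)"
proof -
  have lin: "bounded_linear M" and scale: "M (hscale c f) = hscale c (M f)" for c f
    using M by (auto simp: bounded_operator_def)
  obtain C where C: "C > 0" "\<And>f. norm (M f) \<le> norm f * C"
    using bounded_linear.pos_bounded[OF lin] by blast
  have "\<exists>a. \<forall>f. hinner (M f) g = hinner f a" for g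
  proof -
    define b where "b = (\<lambda>n. cnj (hinner (M (h2_of (\<lambda>z. z ^ n))) g))"
    have M_poly: "hinner (M (\<Sum>n<N. hscale (c n) (h2_of (\<lambda>z. z ^ n)))) g = (\<Sum>n<N. c n * cnj (b n))" for c N
      by (simp add: linear_sum[OF bounded_linear.linear[OF lin]] scale hinner_sum_left hinner_hscale_left b_def)
    have "(\<Sum>n<N. (cmod (b n))\<^sup>2) \<le> (C * norm g)\<^sup>2" for N
    proof -
      \<comment> \<open>Testing the functional on the polynomial whose own coefficients are
        \<open>b\<close> yields \<open>s\<close>, the square of the norm of \<open>p\<close>. The
        functional is bounded by \<open>C * norm g\<close>, so one factor \<open>norm p\<close>
        cancels.\<close>
      define p where "p = (\<Sum>n<N. hscale (b n) (h2_of (\<lambda>z. z ^ n)))"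
      define s where "s = (\<Sum>n<N. (cmod (b n))\<^sup>2)"
      have s0: "s \<ge> 0"
        by (simp add: s_def sum_nonneg)
      have "hcoeff p k = (if k < N then b k else 0)" for k
        by (simp add: p_def if_distrib[of "\<lambda>x. _ * x"] cong: if_cong)
      then have "(\<lambda>k. (cmod (hcoeff p k))\<^sup>2) = (\<lambda>k. if k \<in> {..<N} then (cmod (b k))\<^sup>2 else 0)"
        by auto
      then have p: "(norm p)\<^sup>2 = s"
        unfolding norm_hardy2_square s_def using sums_If_finite_set[of "{..<N}" "\<lambda>k. (cmod (b k))\<^sup>2"]
        by (simp add: sums_unique[symmetric])
      have "of_real s = hinner (M p) g"
        unfolding p_def M_poly s_def of_real_sum complex_norm_square ..
      then have "s = cmod (hinner (M p) g)"
        using s0 by (metis norm_of_real abs_of_nonneg)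
      also have "\<dots> \<le> norm (M p) * norm g"
        by (rule cmod_hinner_le)
      also have "\<dots> \<le> (norm p * C) * norm g"
        by (intro mult_right_mono C) auto
      finally have "s \<le> norm p * (C * norm g)"
        by simp
      then have "norm p * norm p \<le> norm p * (C * norm g)"
        by (simp add: p[symmetric] power2_eq_square)
      then have "norm p \<le> C * norm g"
        using C(1) by (cases "norm p = 0") auto
      then show ?thesis
        unfolding s_def[symmetric] p[symmetric] by (intro power_mono) auto
    qed
    then have "summable (\<lambda>n. (cmod (b n))\<^sup>2)"
      by (intro summableI_nonneg_bounded) auto
    then obtain a where a: "hcoeff a = b"
      using ex_hardy2_hcoeff by blast
    have "hinner (M f) g = hinner f a" for f
    proof (rule LIMSEQ_unique)
      show "(\<lambda>N. hinner (M (htrunc N f)) g) \<longlonglongrightarrow> hinner (M f) g"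
        by (intro bounded_linear.tendsto[OF bounded_linear_hinner_left] bounded_linear.tendsto[OF lin] htrunc_tendsto)
      show "(\<lambda>N. hinner (M (htrunc N f)) g) \<longlonglongrightarrow> hinner f a"
        unfolding htrunc_def M_poly hinner_def[of f a] a[symmetric] by (intro summable_LIMSEQ summable_hinner)
    qed
    then show ?thesis
      by blast
  qed
  then show ?thesis
    by metis
qed

lemma hinner_hadjoint:
  assumes "bounded_operator M"
  shows "hinner f (hadjoint M g) = hinner (M f) g"
proof -
  have "\<forall>f g. hinner (M f) g = hinner f (hadjoint M g)"
    unfolding hadjoint_def by (rule someI_ex[OF ex_hadjoint[OF assms]])
  then show ?thesis
    by simp
qed

section \<open>Adjoints of multiplication operators\<close>

lemma h_infinity_cnj_cnj:
  assumes "\<phi> \<in> h_infinity"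
  shows "(\<lambda>z. cnj (\<phi> (cnj z))) \<in> h_infinity"
proof -
  have "cnj ` unit_disc = unit_disc"
    by (auto simp: image_cnj_conv_vimage_cnj)
  then have "(\<lambda>z. cnj (\<phi> (cnj z))) holomorphic_on unit_disc"
    using holomorphic_on_compose_cnj_cnj[of \<phi> unit_disc] assms
    by (simp add: h_infinity_def o_def)
  moreover obtain C where C: "\<And>z. z \<in> unit_disc \<Longrightarrow> cmod (\<phi> z) \<le> C"
    using h_infinityE[OF assms] by blast
  then have "cmod (cnj (\<phi> (cnj z))) \<le> C" if "z \<in> unit_disc" for z
    using that by simp
  ultimately show ?thesis
    unfolding h_infinity_def bounded_iff by blast
qed

text \<open>All later facts about the calculus come from this relation: on the other side of the
  inner product stands a pointwise multiplication.\<close>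

lemma hinner_shift_calculus:
  assumes "\<phi> \<in> h_infinity"
  shows "hinner f (shift_calculus \<phi> g) = hinner (mult_operator (\<lambda>z. cnj (\<phi> (cnj z))) f) g"
  unfolding shift_calculus_def
  by (intro hinner_hadjoint bounded_operator_mult_operator h_infinity_cnj_cnj assms)

text \<open>An adjoint is bounded by the bound of the original operator: insert
  \<open>h = shift_calculus \<phi> g\<close> itself as the test vector and cancel one factor
  \<open>norm h\<close>.\<close>

lemma norm_shift_calculus_le:
  assumes \<phi>: "\<phi> \<in> h_infinity" and C: "\<And>z. z \<in> unit_disc \<Longrightarrow> cmod (\<phi> z) \<le> C"
  shows "norm (shift_calculus \<phi> g) \<le> C * norm g"
proof -
  define h where "h = shift_calculus \<phi> g"
  define M where "M = mult_operator (\<lambda>z. cnj (\<phi> (cnj z)))"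
  have "0 \<le> cmod (\<phi> 0)"
    by simp
  also have "\<dots> \<le> C"
    by (rule C) simp
  finally have C0: "C \<ge> 0" .
  have "norm h * norm h = inner (M h) g"
    using hinner_shift_calculus[OF \<phi>, of h g]
    by (simp add: h_def M_def inner_hardy2_def flip: power2_eq_square power2_norm_eq_inner)
       (simp add: inner_hardy2_def power2_norm_eq_inner)
  also have "\<dots> \<le> norm (M h) * norm g"
    by (rule norm_cauchy_schwarz)
  also have "\<dots> \<le> (C * norm h) * norm g"
    unfolding M_def
    by (intro mult_right_mono norm_mult_operator_le)
       (use C h_infinity_cnj_cnj[OF \<phi>] in \<open>auto simp: h_infinity_def\<close>)
  finally have "norm h * norm h \<le> norm h * (C * norm g)"
    by (simp add: mult_ac)
  then have "norm h \<le> C * norm g"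
    using C0 by (cases "norm h = 0") auto
  then show ?thesis
    by (simp add: h_def)
qed

lemma bounded_operator_shift_calculus:
  assumes "\<phi> \<in> h_infinity"
  shows "bounded_operator (shift_calculus \<phi>)"
  unfolding bounded_operator_def
proof (intro conjI allI)
  obtain C where C: "\<And>z. z \<in> unit_disc \<Longrightarrow> cmod (\<phi> z) \<le> C"
    using h_infinityE[OF assms] by blast
  show scale: "shift_calculus \<phi> (hscale c f) = hscale c (shift_calculus \<phi> f)" for c f
    by (rule hinner_right_eqI) (simp add: hinner_shift_calculus[OF assms] hinner_hscale_right)
  show "bounded_linear (shift_calculus \<phi>)"
  proof (rule bounded_linear_intro)
    show "shift_calculus \<phi> (f + g) = shift_calculus \<phi> f + shift_calculus \<phi> g" for f g
      by (rule hinner_right_eqI) (simp add: hinner_shift_calculus[OF assms] hinner_add_right)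
    show "shift_calculus \<phi> (r *\<^sub>R f) = r *\<^sub>R shift_calculus \<phi> f" for r f
      by (simp add: scaleR_hardy2_def scale)
    show "norm (shift_calculus \<phi> f) \<le> norm f * C" for f
      using norm_shift_calculus_le[OF assms C] by (simp add: mult.commute)
  qed
qed

section \<open>Rotations and powers of the eigenoperator\<close>

lemma
  assumes "cmod lam = 1"
  shows hcoeff_dilation: "hcoeff (dilation lam f) n = lam ^ n * hcoeff f n"
    and hfun_dilation: "z \<in> unit_disc \<Longrightarrow> hfun (dilation lam f) z = hfun f (lam * z)"
proof -
  have "summable (\<lambda>n. (cmod (lam ^ n * hcoeff f n))\<^sup>2)"
    using assms summable_hcoeff[of f] by (simp add: norm_mult norm_power)
  from ex_hardy2_hcoeff[OF this] obtain F where F: "hcoeff F = (\<lambda>n. lam ^ n * hcoeff f n)"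
    by blast
  have hfun_F: "hfun F z = hfun f (lam * z)" if z: "z \<in> unit_disc" for z
  proof (rule sums_unique2)
    show "(\<lambda>n. hcoeff F n * z ^ n) sums hfun F z"
      using z by (rule hfun_sums)
    have "(\<lambda>n. hcoeff f n * (lam * z) ^ n) sums hfun f (lam * z)"
      using z assms by (intro hfun_sums) (simp add: norm_mult)
    then show "(\<lambda>n. hcoeff F n * z ^ n) sums hfun f (lam * z)"
      by (simp add: F power_mult_distrib mult_ac)
  qed
  then have "dilation lam f = F"
    unfolding dilation_def by (intro h2_of_eqI) simp
  then show "hcoeff (dilation lam f) n = lam ^ n * hcoeff f n"
    and "z \<in> unit_disc \<Longrightarrow> hfun (dilation lam f) z = hfun f (lam * z)"
    by (simp_all add: F hfun_F)
qed

lemma hinner_dilation: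
  assumes "cmod lam = 1"
  shows "hinner f (dilation lam g) = hinner (dilation (cnj lam) f) g"
  unfolding hinner_def using assms by (simp add: hcoeff_dilation mult_ac)

lemma orbit_product_h_infinity:
  assumes \<phi>: "\<phi> \<in> h_infinity" and lam: "cmod lam = 1"
  shows "orbit_product lam n \<phi> \<in> h_infinity"
proof -
  have disc: "lam ^ k * z \<in> unit_disc" if "z \<in> unit_disc" for k z
    using that lam by (simp add: norm_mult norm_power)
  have "(\<lambda>z. \<phi> (lam ^ k * z)) holomorphic_on unit_disc" for k
  proof (rule holomorphic_on_compose_gen[of "\<lambda>z. lam ^ k * z" unit_disc \<phi> unit_disc, unfolded o_def])
    show "(\<lambda>z. lam ^ k * z) ` unit_disc \<subseteq> unit_disc"
      using disc by blast
  qed (use \<phi> in \<open>auto simp: h_infinity_def intro!: holomorphic_intros\<close>)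
  then have "orbit_product lam n \<phi> holomorphic_on unit_disc"
    unfolding orbit_product_def[abs_def] by (intro holomorphic_on_prod)
  moreover obtain C where C: "C > 0" "\<And>z. z \<in> unit_disc \<Longrightarrow> cmod (\<phi> z) \<le> C"
    using h_infinityE[OF \<phi>] by blast
  have "cmod (orbit_product lam n \<phi> z) \<le> C ^ n" if "z \<in> unit_disc" for z
    unfolding orbit_product_def prod_norm[symmetric]
    using prod_mono[of "{..<n}" "\<lambda>k. cmod (\<phi> (lam ^ k * z))" "\<lambda>_. C"] C(2) disc[OF that] by simp
  ultimately show ?thesis
    unfolding h_infinity_def bounded_iff by blast
qed

text \<open>The adjoint \<open>A\<close> of the operator is a weighted rotation, sending f(z) to
  \<open>\<psi>\<close>(z) times f at \<open>cnj lam * z\<close>. Iteration collects the weights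
  along the orbit of the rotation, and after \<open>n\<close> steps the rotation itself is the
  identity.\<close>

lemma funpow_dilation_shift_calculus:
  assumes \<phi>: "\<phi> \<in> h_infinity" and n: "n > 0" and lam: "lam ^ n = 1"
  shows "(dilation lam \<circ> shift_calculus \<phi>) ^^ n = shift_calculus (orbit_product lam n \<phi>)"
proof -
  have norm_lam: "cmod lam = 1"
    using n lam by (metis norm_one norm_power power_eq_1_iff norm_ge_zero less_irrefl)
  define \<psi> where "\<psi> = (\<lambda>z. cnj (\<phi> (cnj z)))"
  have \<psi>: "\<psi> \<in> h_infinity"
    unfolding \<psi>_def by (rule h_infinity_cnj_cnj[OF \<phi>])
  define T where "T = dilation lam \<circ> shift_calculus \<phi>"
  define A where "A = mult_operator \<psi> \<circ> dilation (cnj lam)"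
  have adj: "hinner f (T g) = hinner (A f) g" for f g
    by (simp add: T_def A_def \<psi>_def hinner_dilation[OF norm_lam] hinner_shift_calculus[OF \<phi>])
  have adj_pow: "hinner f ((T ^^ m) g) = hinner ((A ^^ m) f) g" for f g m
    by (induction m arbitrary: f) (simp_all add: adj funpow_swap1[of A])
  have hfun_A: "hfun ((A ^^ m) f) z = (\<Prod>k<m. \<psi> (cnj lam ^ k * z)) * hfun f (cnj lam ^ m * z)"
    if "z \<in> unit_disc" for f z m
    using that
  proof (induction m arbitrary: z)
    case (Suc m)
    have z: "cnj lam * z \<in> unit_disc"
      using Suc.prems norm_lam by (simp add: norm_mult)
    have "hfun ((A ^^ Suc m) f) z = \<psi> z * hfun ((A ^^ m) f) (cnj lam * z)"
      using Suc.prems norm_lam by (simp add: A_def hfun_mult_operator_h_infinity[OF \<psi>] hfun_dilation)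
    also have "\<dots> = \<psi> z * ((\<Prod>k<m. \<psi> (cnj lam ^ Suc k * z)) * hfun f (cnj lam ^ Suc m * z))"
      unfolding Suc.IH[OF z] by (simp add: mult_ac)
    finally show ?case
      by (simp only: prod.lessThan_Suc_shift power_0 mult_1_left mult.assoc)
  qed simp
  have "(T ^^ n) g = shift_calculus (orbit_product lam n \<phi>) g" for g
  proof (rule hinner_right_eqI)
    fix f
    have "(A ^^ n) f = mult_operator (\<lambda>z. cnj (orbit_product lam n \<phi> (cnj z))) f"
    proof (rule hardy2_eqI_hfun)
      fix z assume z: "z \<in> unit_disc"
      have "cnj lam ^ n = 1"
        using lam by (metis complex_cnj_one complex_cnj_power)
      then have "hfun ((A ^^ n) f) z = (\<Prod>k<n. \<psi> (cnj lam ^ k * z)) * hfun f z"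
        by (simp add: hfun_A[OF z])
      also have "(\<Prod>k<n. \<psi> (cnj lam ^ k * z)) = cnj (orbit_product lam n \<phi> (cnj z))"
        by (simp add: \<psi>_def orbit_product_def)
      finally show "hfun ((A ^^ n) f) z = hfun (mult_operator (\<lambda>z. cnj (orbit_product lam n \<phi> (cnj z))) f) z"
        using z by (simp add: hfun_mult_operator_h_infinity h_infinity_cnj_cnj orbit_product_h_infinity \<phi> norm_lam)
    qed
    then show "hinner f ((T ^^ n) g) = hinner f (shift_calculus (orbit_product lam n \<phi>) g)"
      by (simp add: adj_pow hinner_shift_calculus orbit_product_h_infinity \<phi> norm_lam)
  qed
  then show ?thesis
    by (auto simp: T_def)
qed

text \<open>Passing to adjoints reverses the order of the factors, which is harmless for
  multiplication operators.\<close>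

lemma shift_calculus_inverse:
  assumes \<phi>: "\<phi> \<in> h_infinity" and \<psi>: "\<psi> \<in> h_infinity"
    and inv: "\<And>z. z \<in> unit_disc \<Longrightarrow> \<phi> z * \<psi> z = 1"
  shows "shift_calculus \<phi> (shift_calculus \<psi> g) = g"
proof (rule hinner_right_eqI)
  fix f
  have "mult_operator (\<lambda>z. cnj (\<psi> (cnj z))) (mult_operator (\<lambda>z. cnj (\<phi> (cnj z))) f) = f"
  proof (rule hardy2_eqI_hfun)
    fix z assume z: "z \<in> unit_disc"
    then have "cnj (\<phi> (cnj z) * \<psi> (cnj z)) = 1"
      by (subst inv) auto
    then have "cnj (\<psi> (cnj z)) * (cnj (\<phi> (cnj z)) * hfun f z) = hfun f z"
      by (simp add: mult.assoc[symmetric] mult.commute[of "cnj (\<psi> _)"])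
    then show "hfun (mult_operator (\<lambda>z. cnj (\<psi> (cnj z))) (mult_operator (\<lambda>z. cnj (\<phi> (cnj z))) f)) z = hfun f z"
      using z by (simp add: hfun_mult_operator_h_infinity h_infinity_cnj_cnj \<phi> \<psi>)
  qed
  then show "hinner f (shift_calculus \<phi> (shift_calculus \<psi> g)) = hinner f g"
    by (simp add: hinner_shift_calculus \<phi> \<psi>)
qed

subsection \<open>Eigenvectors and hypercyclicity\<close>

lemma ex_kernel:
  assumes "cmod a < 1"
  shows "\<exists>k. \<forall>n. hcoeff k n = a ^ n"
proof -
  have "summable (\<lambda>n. ((cmod a)\<^sup>2) ^ n)"
    using assms by (intro summable_geometric) (simp add: abs_square_less_1)
  then have "summable (\<lambda>n. (cmod (a ^ n))\<^sup>2)"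
    by (simp add: norm_power flip: power_mult) (simp add: mult.commute)
  from ex_hardy2_hcoeff[OF this] obtain k where "hcoeff k = (\<lambda>n. a ^ n)"
    by blast
  then show ?thesis
    by (intro exI[of _ k]) simp
qed

text \<open>The Szego kernel with parameter \<open>cnj a\<close>, i.e. the function \<open>1 / (1 - a * z)\<close>.\<close>
definition kernel :: "complex \<Rightarrow> hardy2" where
  "kernel a = (SOME k. \<forall>n. hcoeff k n = a ^ n)"

lemma hcoeff_kernel: "cmod a < 1 \<Longrightarrow> hcoeff (kernel a) n = a ^ n"
  unfolding kernel_def using someI_ex[OF ex_kernel] by simp

lemma hinner_kernel:
  assumes "cmod a < 1"
  shows "hinner f (kernel a) = hfun f (cnj a)"
  using sums_unique[OF hfun_sums[of "cnj a" f]] assms by (simp add: hinner_def hcoeff_kernel)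

text \<open>Reproducing kernels are eigenvectors of adjoints of multiplications. The conjugations in
  the calculus and in the inner product cancel, leaving \<open>\<phi> a\<close> as the
  eigenvalue.\<close>

lemma shift_calculus_kernel:
  assumes \<phi>: "\<phi> \<in> h_infinity" and a: "cmod a < 1"
  shows "shift_calculus \<phi> (kernel a) = hscale (\<phi> a) (kernel a)"
  by (rule hinner_right_eqI)
     (use a in \<open>simp add: hinner_shift_calculus[OF \<phi>] hinner_kernel hinner_hscale_right
        hfun_mult_operator_h_infinity[OF h_infinity_cnj_cnj[OF \<phi>]]\<close>)

lemma closure_kernels:
  assumes W: "subspace W" "\<And>c f. f \<in> W \<Longrightarrow> hscale c f \<in> W"
    and U: "open U" "U \<noteq> {}" "U \<subseteq> unit_disc" "\<And>a. a \<in> U \<Longrightarrow> kernel a \<in> W"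
  shows "closure W = UNIV"
proof (rule ccontr)
  assume "closure W \<noteq> UNIV"
  then obtain g where g: "g \<noteq> 0" "\<And>w. w \<in> closure W \<Longrightarrow> inner g w = 0"
    using closed_subspace_orthogonal[of "closure W"] subspace_closure[OF W(1)] by auto
  have orth: "hinner g w = 0" if "w \<in> W" for w
  proof (rule complex_eqI)
    \<comment> \<open>\<open>inner\<close> sees only the real part of \<open>hinner\<close>; the
      multiple of \<open>w\<close> by \<open>\<i>\<close> supplies the imaginary part, so
      \<open>W\<close> must be closed under complex scaling.\<close>
    have "inner g w = 0" "inner g (hscale \<i> w) = 0"
      using that W(2) closure_subset g(2) by blast+
    then show "Re (hinner g w) = Re 0" "Im (hinner g w) = Im 0"
      by (simp_all add: inner_hardy2_def hinner_hscale_right)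
  qed
  have "hfun g z = 0" if "z \<in> unit_disc" for z
  proof (rule analytic_continuation_open[of "cnj ` U" unit_disc "hfun g" "\<lambda>_. 0"])
    show "open (cnj ` U)"
      unfolding image_cnj_conv_vimage_cnj by (intro open_vimage U continuous_intros)
    show "cnj ` U \<subseteq> unit_disc"
      using U(3) by auto
    show "hfun g z = 0" if z: "z \<in> cnj ` U" for z
    proof -
      obtain a where a: "a \<in> U" "z = cnj a"
        using z by blast
      then have "cmod a < 1"
        using U(3) by auto
      then show ?thesis
        using orth[OF U(4)[OF a(1)]] by (simp add: hinner_kernel a(2))
    qed
  qed (use U that in \<open>auto intro: hfun_holomorphic\<close>)
  then have "g = 0"
    by (intro hardy2_eqI_hfun) simp
  with g(1) show False ..
qed

text \<open>Polynomials with coefficients in a countable dense set of complex numbers suffice,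
  because truncations converge.\<close>

lemma ex_countable_dense_hardy2: "\<exists>D :: hardy2 set. countable D \<and> closure D = UNIV"
proof -
  obtain Q :: "complex set" where Q: "countable Q" "\<And>X. open X \<Longrightarrow> X \<noteq> {} \<Longrightarrow> \<exists>q\<in>Q. q \<in> X"
    using countable_dense_exists by metis
  define D where "D = (\<Union>N. (\<lambda>c. \<Sum>n<N. hscale (c n) (h2_of (\<lambda>z. z ^ n))) ` (\<Pi>\<^sub>E n\<in>{..<N}. Q))"
  have "countable D"
    unfolding D_def by (intro countable_UN countable_image countable_PiE Q) auto
  moreover have "\<exists>d\<in>D. dist d f < e" if e: "e > 0" for f e
  proof -
    obtain N where N: "dist (htrunc N f) f < e / 2"
      using metric_LIMSEQ_D[OF htrunc_tendsto, of "e / 2" f] e by fastforce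
    \<comment> \<open>There are \<open>N\<close> monomials of norm 1, so coefficient errors below
      \<open>\<delta>\<close> add up to at most \<open>e / 2\<close>; the \<open>+ 1\<close> avoids
      division by zero for \<open>N = 0\<close>.\<close>
    define \<delta> where "\<delta> = e / (2 * (real N + 1))"
    have \<delta>: "\<delta> > 0"
      using e by (simp add: \<delta>_def)
    have "\<exists>q\<in>Q. q \<in> ball (hcoeff f n) \<delta>" for n
      using \<delta> by (intro Q) auto
    then obtain q where q: "\<And>n. q n \<in> Q" "\<And>n. dist (hcoeff f n) (q n) < \<delta>"
      unfolding mem_ball by metis
    define d where "d = (\<Sum>n<N. hscale (q n) (h2_of (\<lambda>z. z ^ n)))"
    \<comment> \<open>Members of the countable index set are \<open>undefined\<close> outside
      \<open>{..<N}\<close>, so \<open>q\<close> is restricted to match.\<close>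
    have "d = (\<Sum>n<N. hscale (restrict q {..<N} n) (h2_of (\<lambda>z. z ^ n)))"
      unfolding d_def by (intro sum.cong) auto
    moreover have "restrict q {..<N} \<in> (\<Pi>\<^sub>E n\<in>{..<N}. Q)"
      using q(1) by auto
    ultimately have "d \<in> D"
      unfolding D_def by blast
    moreover have "dist d f < e"
    proof -
      have norm_monom: "norm (h2_of (\<lambda>z. z ^ n)) = 1" for n
      proof -
        have "(norm (h2_of (\<lambda>z. z ^ n)))\<^sup>2 = (\<Sum>k. if k = n then 1 else 0)"
          unfolding norm_hardy2_square by (intro suminf_cong) simp
        also have "\<dots> = 1"
          using sums_unique[OF sums_single[of n "\<lambda>_. 1::real"]] by simp
        finally show ?thesis
          by (simp add: power2_eq_1_iff) (metis norm_ge_zero neg_0_le_iff_le not_one_le_zero)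
      qed
      have "htrunc N f - d = (\<Sum>n<N. hscale (hcoeff f n - q n) (h2_of (\<lambda>z. z ^ n)))"
        by (rule hardy2_eqI) (simp add: htrunc_def d_def algebra_simps sum_subtractf)
      then have "norm (htrunc N f - d) \<le> (\<Sum>n<N. \<delta>)"
        by (simp only:) (rule sum_norm_le, use q(2) in \<open>simp add: norm_monom dist_norm less_imp_le\<close>)
      also have "\<dots> \<le> e / 2"
        using e by (simp add: \<delta>_def field_simps)
      finally have "dist d (htrunc N f) \<le> e / 2"
        by (simp add: dist_norm norm_minus_commute)
      then show ?thesis
        using N dist_triangle[of d f "htrunc N f"] by linarith
    qed
    ultimately show ?thesis ..
  qed
  then have "closure D = UNIV"
    by (auto simp: closure_approachable)
  ultimately show ?thesis
    by blast
qed

lemma bounded_operator_funpow: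
  assumes "bounded_operator S"
  shows "bounded_operator (S ^^ m)"
proof (induction m)
  case 0
  then show ?case
    by (simp add: bounded_operator_def bounded_linear_ident id_def)
next
  case (Suc m)
  then show ?case
    using assms bounded_linear_compose[of S "S ^^ m"] by (simp add: bounded_operator_def o_def)
qed

lemma bounded_linear_hscale: "bounded_linear (hscale c)"
proof (rule bounded_linear_intro)
  show "hscale c (f + g) = hscale c f + hscale c g" for f g
    by (rule hardy2_eqI) (simp add: ring_distribs)
  show "hscale c (r *\<^sub>R f) = r *\<^sub>R hscale c f" for r f
    by (rule hardy2_eqI) simp
  show "norm (hscale c f) \<le> norm f * cmod c" for f
    by simp
qed

lemma hscale_hscale: "hscale c (hscale d f) = hscale (c * d) f"
  by (rule hardy2_eqI) simp

lemma hscale_one [simp]: "hscale 1 f = f"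
  by (rule hardy2_eqI) simp

lemma tendsto_hscale_power:
  assumes "cmod c < 1"
  shows "(\<lambda>m. hscale (c ^ m) f) \<longlonglongrightarrow> 0"
proof (rule tendsto_norm_zero_cancel)
  have "(\<lambda>m. cmod c ^ m * norm f) \<longlonglongrightarrow> 0 * norm f"
    using assms by (intro tendsto_intros LIMSEQ_realpow_zero) auto
  then show "(\<lambda>m. norm (hscale (c ^ m) f)) \<longlonglongrightarrow> 0"
    by (simp add: norm_power)
qed

text \<open>The points with modulus of \<open>\<phi>\<close> below 1, and those with modulus above
  1, form nonempty open sets. Powers of S shrink the kernels of the first set to 0; kernels of the
  second have preimages that shrink to 0.\<close>

lemma hypercyclic_shift_calculus:
  assumes \<phi>: "\<phi> \<in> h_infinity"
    and U: "a \<in> unit_disc" "cmod (\<phi> a) < 1"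
    and V: "b \<in> unit_disc" "cmod (\<phi> b) > 1"
  shows "hypercyclic (shift_calculus \<phi>)"
proof -
  define S where "S = shift_calculus \<phi>"
  have S: "bounded_operator S"
    unfolding S_def by (rule bounded_operator_shift_calculus[OF \<phi>])
  have lin: "bounded_linear (S ^^ m)" and scale: "(S ^^ m) (hscale c f) = hscale c ((S ^^ m) f)" for m c f
    using bounded_operator_funpow[OF S] by (auto simp: bounded_operator_def)
  have add: "(S ^^ m) (f + g) = (S ^^ m) f + (S ^^ m) g"
    and scaleR: "(S ^^ m) (r *\<^sub>R f) = r *\<^sub>R (S ^^ m) f"
    and zero: "(S ^^ m) 0 = 0" for m f g r
    using bounded_linear.linear[OF lin] by (simp_all add: linear_add linear_cmul linear_0)
  have S_kernel: "(S ^^ m) (kernel a) = hscale (\<phi> a ^ m) (kernel a)" if "cmod a < 1" for m a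
  proof (induction m)
    case (Suc m)
    then show ?case
      using scale[of 1] by (simp add: S_def shift_calculus_kernel[OF \<phi> that] hscale_hscale mult.commute)
  qed simp
  have cont: "continuous_on unit_disc (\<lambda>z. cmod (\<phi> z))"
    using \<phi> by (auto simp: h_infinity_def intro!: continuous_intros holomorphic_on_imp_continuous_on)
  have open_U: "open {z \<in> unit_disc. cmod (\<phi> z) < 1}" and open_V: "open {z \<in> unit_disc. cmod (\<phi> z) > 1}"
    using continuous_open_preimage[OF cont, of "{..<1}"] continuous_open_preimage[OF cont, of "{1<..}"]
    by (simp_all add: vimage_def Int_def)
  define X where "X = {x. (\<lambda>m. (S ^^ m) x) \<longlonglongrightarrow> 0}"
  \<comment> \<open>Asking only for some null sequence of preimages, instead of a right inverse of
    \<open>S\<close>, makes \<open>Y\<close> a subspace without any choice of preimages having to be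
    linear.\<close>
  define Y where "Y = {y. \<exists>u. u \<longlonglongrightarrow> 0 \<and> (\<forall>m. (S ^^ m) (u m) = y)}"
  have X: "closure X = UNIV"
  proof (rule closure_kernels)
    show "subspace X"
      unfolding subspace_def X_def
      using tendsto_scaleR[OF tendsto_const, where b = "0::hardy2"]
      by (auto simp: zero add scaleR intro: tendsto_add_zero)
    show "hscale c f \<in> X" if "f \<in> X" for c f
      using bounded_linear.tendsto_zero[OF bounded_linear_hscale] that by (simp add: X_def scale)
    show "open {z \<in> unit_disc. cmod (\<phi> z) < 1}"
      by (fact open_U)
    show "{z \<in> unit_disc. cmod (\<phi> z) < 1} \<noteq> {}"
      using U by blast
    show "kernel a \<in> X" if "a \<in> {z \<in> unit_disc. cmod (\<phi> z) < 1}" for a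
      using that by (simp add: X_def S_kernel tendsto_hscale_power)
  qed auto
  have Y: "closure Y = UNIV"
  proof (rule closure_kernels)
    show "subspace Y"
      unfolding subspace_def
    proof (intro conjI ballI allI)
      show "0 \<in> Y"
        unfolding Y_def using zero by (auto intro!: exI[of _ "\<lambda>_. 0"])
      show "x + y \<in> Y" if xy: "x \<in> Y" "y \<in> Y" for x y
      proof -
        obtain u v where "u \<longlonglongrightarrow> 0" "\<And>m. (S ^^ m) (u m) = x" "v \<longlonglongrightarrow> 0" "\<And>m. (S ^^ m) (v m) = y"
          using xy unfolding Y_def by blast
        then show ?thesis
          unfolding Y_def by (auto intro!: exI[of _ "\<lambda>m. u m + v m"] tendsto_add_zero simp: add)
      qed
      show "r *\<^sub>R x \<in> Y" if x: "x \<in> Y" for r x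
      proof -
        obtain u where "u \<longlonglongrightarrow> 0" "\<And>m. (S ^^ m) (u m) = x"
          using x unfolding Y_def by blast
        then show ?thesis
          unfolding Y_def using tendsto_scaleR[OF tendsto_const, of u 0 sequentially r]
          by (auto intro!: exI[of _ "\<lambda>m. r *\<^sub>R u m"] simp: scaleR)
      qed
    qed
    show "hscale c f \<in> Y" if f: "f \<in> Y" for c f
    proof -
      obtain u where "u \<longlonglongrightarrow> 0" "\<And>m. (S ^^ m) (u m) = f"
        using f unfolding Y_def by blast
      then show ?thesis
        unfolding Y_def using bounded_linear.tendsto_zero[OF bounded_linear_hscale, of u sequentially c]
        by (auto intro!: exI[of _ "\<lambda>m. hscale c (u m)"] simp: scale)
    qed
    show "open {z \<in> unit_disc. cmod (\<phi> z) > 1}"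
      by (fact open_V)
    show "{z \<in> unit_disc. cmod (\<phi> z) > 1} \<noteq> {}"
      using V by blast
    show "kernel a \<in> Y" if "a \<in> {z \<in> unit_disc. cmod (\<phi> z) > 1}" for a
    proof -
      have a: "cmod a < 1" "cmod (\<phi> a) > 1"
        using that by auto
      then have "(\<lambda>m. hscale (inverse (\<phi> a) ^ m) (kernel a)) \<longlonglongrightarrow> 0"
        by (intro tendsto_hscale_power) (simp add: norm_inverse inverse_less_1_iff)
      moreover have "(S ^^ m) (hscale (inverse (\<phi> a) ^ m) (kernel a)) = kernel a" for m
      proof -
        have "\<phi> a \<noteq> 0"
          using a(2) by auto
        then show ?thesis
          by (simp add: scale S_kernel[OF a(1)] hscale_hscale power_inverse)
      qed
      ultimately show ?thesis
        unfolding Y_def by blast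
    qed
  qed auto
  obtain D :: "hardy2 set" where D: "countable D" "closure D = UNIV"
    using ex_countable_dense_hardy2 by blast
  have "\<exists>f. closure (range (\<lambda>m. (S ^^ m) f)) = UNIV"
    using S by (intro hypercyclicity_criterion[OF _ D X _ Y]) (auto simp: X_def Y_def bounded_operator_def)
  then show ?thesis
    by (simp add: hypercyclic_def S_def)
qed

section \<open>Dynamics of the operator from those of its n-th power\<close>

theorem proposition4p6:
  fixes lam :: complex and \<phi> :: "complex \<Rightarrow> complex" and n :: nat
    and T :: "hardy2 \<Rightarrow> hardy2"
  assumes "\<phi> \<in> h_infinity"
    and "T = dilation lam \<circ> shift_calculus \<phi>"
    and "extended_eigenoperator lam T"
    and "n > 0" and "lam ^ n = 1"
    and "\<not> (\<exists>c \<in> sphere 0 1. \<forall>z \<in> unit_disc. orbit_product lam n \<phi> z = c)"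
  shows "hypercyclic T \<longleftrightarrow> orbit_product lam n \<phi> ` unit_disc \<inter> sphere 0 1 \<noteq> {}"
proof -
  define \<Phi> where "\<Phi> = orbit_product lam n \<phi>"
  have "cmod lam = 1"
    using assms(4,5) by (metis norm_one norm_power power_eq_1_iff norm_ge_zero less_irrefl)
  then have \<Phi>: "\<Phi> \<in> h_infinity"
    unfolding \<Phi>_def by (intro orbit_product_h_infinity assms)
  have T_n: "T ^^ n = shift_calculus \<Phi>"
    unfolding \<Phi>_def assms(2) by (intro funpow_dilation_shift_calculus assms)
  have hol: "\<Phi> holomorphic_on unit_disc"
    using \<Phi> by (simp add: h_infinity_def)
  show ?thesis
    unfolding \<Phi>_def[symmetric]
  proof
    assume "\<Phi> ` unit_disc \<inter> sphere 0 1 \<noteq> {}"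
    then obtain a where a: "a \<in> unit_disc" "cmod (\<Phi> a) = 1"
      by auto
    \<comment> \<open>A constant value would equal \<open>\<Phi> a\<close>, which lies on the
      circle, contrary to the last assumption.\<close>
    have "\<not> \<Phi> constant_on unit_disc"
      using assms(6) a unfolding constant_on_def \<Phi>_def[symmetric] by (metis mem_sphere_0)
    then have "open (\<Phi> ` unit_disc)"
      using open_mapping_thm[OF hol] by simp
    then obtain e where e: "e > 0" "ball (\<Phi> a) e \<subseteq> \<Phi> ` unit_disc"
      using a(1) by (meson imageI openE)
    \<comment> \<open>Moving \<open>\<Phi> a\<close> radially by \<open>t < e\<close> stays inside
      the ball and gives values of modulus \<open>1 - t\<close> and \<open>1 + t\<close>.\<close>
    define t where "t = min (e / 2) (1 / 2)"
    have t: "0 < t" "t < 1" "t < e"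
      using e(1) by (auto simp: t_def)
    have "of_real (1 - t) * \<Phi> a \<in> ball (\<Phi> a) e" "of_real (1 + t) * \<Phi> a \<in> ball (\<Phi> a) e"
      using a(2) t by (simp_all add: dist_norm algebra_simps norm_mult)
    then have "of_real (1 - t) * \<Phi> a \<in> \<Phi> ` unit_disc" "of_real (1 + t) * \<Phi> a \<in> \<Phi> ` unit_disc"
      using e(2) by blast+
    then obtain u v where u: "u \<in> unit_disc" "\<Phi> u = of_real (1 - t) * \<Phi> a"
      and v: "v \<in> unit_disc" "\<Phi> v = of_real (1 + t) * \<Phi> a"
      unfolding image_iff by metis
    have "cmod (\<Phi> u) < 1" "cmod (\<Phi> v) > 1"
      unfolding u(2) v(2) norm_mult norm_of_real a(2) using t by auto
    with \<Phi> u(1) v(1) have "hypercyclic (T ^^ n)"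
      unfolding T_n by (intro hypercyclic_shift_calculus)
    then obtain f where f: "closure (range (\<lambda>m. ((T ^^ n) ^^ m) f)) = UNIV"
      by (auto simp: hypercyclic_def)
    have "range (\<lambda>m. ((T ^^ n) ^^ m) f) \<subseteq> range (\<lambda>m. (T ^^ m) f)"
      by (auto simp: funpow_mult)
    from closure_mono[OF this] f show "hypercyclic T"
      unfolding hypercyclic_def by blast
  next
    assume "hypercyclic T"
    then obtain f where f: "closure (range (\<lambda>m. (T ^^ m) f)) = UNIV"
      by (auto simp: hypercyclic_def)
    \<comment> \<open>Division with remainder: only the \<open>n\<close> vectors
      \<open>(T ^^ r) f\<close> with \<open>r < n\<close> occur as starting points for powers of
      \<open>T ^^ n\<close>.\<close>
    have orbit: "(T ^^ m) f = ((T ^^ n) ^^ (m div n)) ((T ^^ (m mod n)) f)" for m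
      by (metis funpow_add funpow_mult comp_apply div_mult_mod_eq mult.commute)
    show "\<Phi> ` unit_disc \<inter> sphere 0 1 \<noteq> {}"
    proof
      assume empty: "\<Phi> ` unit_disc \<inter> sphere 0 1 = {}"
      \<comment> \<open>A connected set of reals that misses 1 lies entirely on one side of
        it.\<close>
      have "connected ((\<lambda>z. cmod (\<Phi> z)) ` unit_disc)"
        by (intro connected_continuous_image continuous_intros holomorphic_on_imp_continuous_on hol) auto
      moreover have "1 \<notin> (\<lambda>z. cmod (\<Phi> z)) ` unit_disc"
        using empty by fastforce
      ultimately consider "\<And>z. z \<in> unit_disc \<Longrightarrow> cmod (\<Phi> z) < 1" | "\<And>z. z \<in> unit_disc \<Longrightarrow> cmod (\<Phi> z) > 1"
        unfolding connected_iff_interval by (metis imageI linorder_not_le)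
      then show False
      proof cases
        case 1
        have contr: "norm ((T ^^ n) g) \<le> norm g" for g
          unfolding T_n using norm_shift_calculus_le[OF \<Phi>, of 1] 1 by (simp add: less_imp_le)
        have "norm (((T ^^ n) ^^ q) g) \<le> norm g" for q g
          by (induction q) (auto intro: order.trans[OF contr])
        then have "norm ((T ^^ m) f) \<le> Max ((\<lambda>r. norm ((T ^^ r) f)) ` {..<n})" for m
          unfolding orbit[of m] using assms(4)
          by (intro order.trans[OF _ Max_ge[of _ "norm ((T ^^ (m mod n)) f)"]]) auto
        then have "bounded (range (\<lambda>m. (T ^^ m) f))"
          unfolding bounded_iff by blast
        then have "bounded (UNIV :: hardy2 set)"
          using f bounded_closure by metis
        then obtain b where b: "\<And>g :: hardy2. norm g \<le> b"
          unfolding bounded_iff by blast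
        \<comment> \<open>The constant function 1, as its coefficients are \<open>0 ^ n\<close>.
          Multiplied by \<open>\<bar>b\<bar> + 1\<close> it has a coefficient, hence a norm,
          exceeding \<open>b\<close>.\<close>
        define e where "e = kernel 0"
        have "cmod (hcoeff (hscale (of_real (\<bar>b\<bar> + 1)) e) 0) \<le> b"
          using cmod_hcoeff_le b by (rule order.trans)
        then show False
          by (simp add: e_def hcoeff_kernel norm_mult del: of_real_add)
      next
        case 2
        define \<Psi> where "\<Psi> = (\<lambda>z. inverse (\<Phi> z))"
        have nz: "\<Phi> z \<noteq> 0" if "z \<in> unit_disc" for z
          using 2[OF that] by auto
        have \<Psi>_le: "cmod (\<Psi> z) \<le> 1" if "z \<in> unit_disc" for z
          using 2[OF that] by (simp add: \<Psi>_def norm_inverse inverse_le_1_iff)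
        have "\<Psi> holomorphic_on unit_disc"
          unfolding \<Psi>_def by (intro holomorphic_intros hol nz)
        then have \<Psi>: "\<Psi> \<in> h_infinity"
          using \<Psi>_le unfolding h_infinity_def bounded_iff by blast
        have expand: "norm g \<le> norm ((T ^^ n) g)" for g
        proof -
          have "shift_calculus \<Psi> (shift_calculus \<Phi> g) = g"
            by (rule shift_calculus_inverse[OF \<Psi> \<Phi>]) (simp add: \<Psi>_def nz)
          then show ?thesis
            unfolding T_n using norm_shift_calculus_le[OF \<Psi> \<Psi>_le, of "shift_calculus \<Phi> g"] by simp
        qed
        have expand_pow: "norm g \<le> norm (((T ^^ n) ^^ q) g)" for q g
          by (induction q) (auto intro: order.trans[OF _ expand])
        \<comment> \<open>Since powers of \<open>T ^^ n\<close> do not decrease norms, the smallest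
          norm among the first \<open>n\<close> orbit vectors bounds the whole orbit from
          below.\<close>
        define \<delta> where "\<delta> = Min ((\<lambda>r. norm ((T ^^ r) f)) ` {..<n})"
        have \<delta>_le: "\<delta> \<le> norm ((T ^^ m) f)" for m
          unfolding orbit[of m] \<delta>_def using assms(4)
          by (intro order.trans[OF Min_le[of _ "norm ((T ^^ (m mod n)) f)"] expand_pow]) auto
        have T_lin: "linear (T ^^ m)" for m
          using bounded_operator_funpow[of T m] assms(3)
          by (simp add: extended_eigenoperator_def bounded_operator_def bounded_linear.linear)
        \<comment> \<open>For \<open>f = 0\<close> the orbit is \<open>{0}\<close>, which is not
          dense in a nonzero space. Otherwise a zero among the first \<open>n\<close> orbit vectors
          would give \<open>(T ^^ n) f = 0\<close>, against \<open>expand\<close>.\<close>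
        have "\<delta> > 0"
        proof (cases "f = 0")
          case True
          then have "range (\<lambda>m. (T ^^ m) f) = {0}"
            using linear_0[OF T_lin] by auto
          then have "(UNIV :: hardy2 set) = {0}"
            using f by simp
          then have "kernel 0 = 0"
            by blast
          then show ?thesis
            using hcoeff_kernel[of 0 0] by simp
        next
          case False
          have "(T ^^ r) f \<noteq> 0" if "r < n" for r
          proof
            assume "(T ^^ r) f = 0"
            then have "(T ^^ (n - r)) ((T ^^ r) f) = 0"
              using linear_0[OF T_lin] by simp
            then have "(T ^^ n) f = 0"
              using that by (metis funpow_add comp_apply le_add_diff_inverse2 less_imp_le)
            then show False
              using expand[of f] False by simp
          qed
          then show ?thesis
            using assms(4) by (auto simp: \<delta>_def Min_gr_iff lessThan_empty_iff)
        qed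
        moreover have "0 \<in> closure (range (\<lambda>m. (T ^^ m) f))"
          using f by simp
        ultimately obtain m where "norm ((T ^^ m) f) < \<delta>"
          unfolding closure_approachable by auto
        then show False
          using \<delta>_le[of m] by simp
      qed
    qed
  qed
qed

end
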